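(* Let $1<p<\infty$, $p'=\frac p{p-1}$ and $t_0>0$. Consider the eigenvalue problem, for $u\ne0$ and $\lambda>0$, $$\big(\operatorname{sgn}(u'')|u''|^{p-1}\big)''=\lambda\,\operatorname{sgn}(u)|u|^{p'-1}\quad(0\le t\le t_0),\qquad u(0)=u(t_0)=u''(0)=u''(t_0)=0.\qquad(\mathrm{E}')$$ The eigenvalues and eigenfunctions of $(\mathrm{E}')$ are fully characterized as follows. For any given constant $c>0$ and $n\in\mathbb N$, $\lambda=\lambda_n$ is of the form $$\lambda_n=\frac{(\pi_{2,p'}\,\pi_{p,2}\,n^2)^p}{t_0^{2p}}\,c^{\,p-p'}=\left(\frac{p'\,\pi_{2,p'}^2\,n^2}{2t_0^2}\right)^p c^{\,p-p'}$$ with corresponding $u(t)=f_{n,c}(t)$ of the form $$f_{n,c}(t)=c\,\sin_{2,p'}\!\left(\frac{\pi_{2,p'}\,n\,t}{t_0}\right).$$ For $p\neq2$, this eigenpair is the unique solution such that the eigenfunction has positive derivative at $t=0$ and changes sign exactly $n-1$ times on $(0,t_0)$.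
   Context: For $1<r,s<\infty$, with $r'=\frac{r}{r-1}$, let $\pi_{r,s}=2\int_0^1\frac{d\tau}{(1-\tau^s)^{1/r}}$, and let $\sin_{r,s}:\mathbb R\to[-1,1]$ be the $2\pi_{r,s}$-periodic odd function, even with respect to the point $\frac{\pi_{r,s}}2$, whose inverse on $[0,\frac{\pi_{r,s}}2]$ is $y\mapsto\int_0^y\frac{d\tau}{(1-\tau^s)^{1/r}}$, $y\in[0,1]$. An eigenpair of $(\mathrm{E}')$ is a pair $(u,\lambda)$ with $\lambda>0$ and a real function $u\not\equiv0$ on $[0,t_0]$ (the eigenfunction) satisfying $(\mathrm{E}')$, in the sense that $u,\ u',\ \operatorname{sgn}(u'')|u''|^{p-1}$ and $(\operatorname{sgn}(u'')|u''|^{p-1})'$ are of class $C^1$ on $[0,t_0]$ and the equation and boundary conditions hold. Here $\mathbb N$ denotes the positive integers. *)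

theory Defs
  imports "HOL-Analysis.Analysis"
begin

definition conj_exp :: "real \<Rightarrow> real" where
  "conj_exp p = p / (p - 1)"

text \<open>The value of the integrand at the singular point \<open>\<tau> = 1\<close> is \<open>1 / 0 = 0\<close>; it is
  irrelevant for the integral.\<close>

definition arcsin_rs :: "real \<Rightarrow> real \<Rightarrow> real \<Rightarrow> real" where
  "arcsin_rs r s y = integral {0..y} (\<lambda>\<tau>. 1 / (1 - \<tau> powr s) powr (1 / r))"

definition pi_rs :: "real \<Rightarrow> real \<Rightarrow> real" where
  "pi_rs r s = 2 * integral {0..1} (\<lambda>\<tau>. 1 / (1 - \<tau> powr s) powr (1 / r))"

text \<open>For \<open>r, s > 1\<close> exactly one function has the properties listed here: the last two determine
  it on \<open>{0..pi_rs r s / 2}\<close>, and the symmetries extend it to the whole line.\<close>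

definition sin_rs :: "real \<Rightarrow> real \<Rightarrow> real \<Rightarrow> real" where
  "sin_rs r s = (THE f.
     (\<forall>x. f x \<in> {-1..1}) \<and>
     (\<forall>x. f (x + 2 * pi_rs r s) = f x) \<and>
     (\<forall>x. f (- x) = - f x) \<and>
     (\<forall>x. f (pi_rs r s / 2 + x) = f (pi_rs r s / 2 - x)) \<and>
     (\<forall>x\<in>{0..pi_rs r s / 2}. f x \<in> {0..1} \<and> arcsin_rs r s (f x) = x) \<and>
     (\<forall>y\<in>{0..1}. arcsin_rs r s y \<in> {0..pi_rs r s / 2} \<and> f (arcsin_rs r s y) = y))"

definition signed_pow :: "real \<Rightarrow> real \<Rightarrow> real" where
  "signed_pow q x = sgn x * \<bar>x\<bar> powr q"

text \<open>Derivatives on \<open>{0..t0}\<close> are taken within the interval, so they are one-sided at the end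
  points and do not depend on the values outside.\<close>

definition deriv_on :: "real \<Rightarrow> (real \<Rightarrow> real) \<Rightarrow> real \<Rightarrow> real" where
  "deriv_on t0 f t = vector_derivative f (at t within {0..t0})"

definition C1_on :: "real \<Rightarrow> (real \<Rightarrow> real) \<Rightarrow> bool" where
  "C1_on t0 f \<longleftrightarrow>
     (\<forall>t\<in>{0..t0}. f differentiable (at t within {0..t0})) \<and> continuous_on {0..t0} (deriv_on t0 f)"

definition eigenpair :: "real \<Rightarrow> real \<Rightarrow> (real \<Rightarrow> real) \<Rightarrow> real \<Rightarrow> bool" where
  "eigenpair p t0 u lam \<longleftrightarrow>
     (let u1 = deriv_on t0 u;
          u2 = deriv_on t0 u1;
          w  = (\<lambda>t. signed_pow (p - 1) (u2 t));
          w1 = deriv_on t0 w;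
          w2 = deriv_on t0 w1
      in lam > 0 \<and> (\<exists>t\<in>{0..t0}. u t \<noteq> 0) \<and>
         C1_on t0 u \<and> C1_on t0 u1 \<and> C1_on t0 w \<and> C1_on t0 w1 \<and>
         (\<forall>t\<in>{0..t0}. w2 t = lam * signed_pow (conj_exp p - 1) (u t)) \<and>
         u 0 = 0 \<and> u t0 = 0 \<and> u2 0 = 0 \<and> u2 t0 = 0)"

text \<open>There are points \<open>s 0 < \<dots> < s k\<close> of the set at which the values of \<open>u\<close> are nonzero and
  alternate in sign (no condition on the values if \<open>k = 0\<close>).\<close>

definition at_least_sign_changes :: "(real \<Rightarrow> real) \<Rightarrow> real set \<Rightarrow> nat \<Rightarrow> bool" where
  "at_least_sign_changes u A k \<longleftrightarrow>
     (\<exists>s :: nat \<Rightarrow> real. (\<forall>i\<le>k. s i \<in> A) \<and>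
        (\<forall>i<k. s i < s (Suc i) \<and> u (s i) * u (s (Suc i)) < 0))"

definition changes_sign_exactly :: "(real \<Rightarrow> real) \<Rightarrow> real set \<Rightarrow> nat \<Rightarrow> bool" where
  "changes_sign_exactly u A k \<longleftrightarrow>
     at_least_sign_changes u A k \<and> \<not> at_least_sign_changes u A (Suc k)"

definition eigval :: "real \<Rightarrow> real \<Rightarrow> nat \<Rightarrow> real \<Rightarrow> real" where
  "eigval p t0 n c =
     (pi_rs 2 (conj_exp p) * pi_rs p 2 * (real n)\<^sup>2) powr p / t0 powr (2 * p)
       * c powr (p - conj_exp p)"

definition eigfun :: "real \<Rightarrow> real \<Rightarrow> nat \<Rightarrow> real \<Rightarrow> real \<Rightarrow> real" where
  "eigfun p t0 n c t =
     c * sin_rs 2 (conj_exp p) (pi_rs 2 (conj_exp p) * real n * t / t0)"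

end

(* With q = p/(p-1) and u'' = |w|^(q-1) sgn w, equation (E') is the system
   u'' = |w|^(q-1) sgn w, w'' = lambda |u|^(q-1) sgn u with u = w = 0 at both end points.
   Rescaling w to -v makes it symmetric, u'' = -mu |v|^(q-1) sgn v and v'' = -mu |u|^(q-1) sgn u,
   and then (u - v)'' has the sign of u - v, which forces u = v.  What remains is the
   second-order equation u'' = -mu |u|^(q-1) sgn u.  It has the conserved energy
   u'^2 / 2 + mu |u|^q / q, hence a unique solution with given nonzero slope at 0, and a scaled
   sin_{2,q} is such a solution; its zeros are the multiples of pi_{2,q}. *)

theory Submission
  imports Defs
begin

section \<open>Signed powers and calculus\<close>

text \<open>The obstacle is that \<open>signed_pow (q - 1)\<close> is not Lipschitz at 0 when q < 2,
  and every eigenfunction starts at 0, so the classical uniqueness theorem does not apply there. At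
  a zero, however, the slope of the solution is nonzero, and the energy identity can be read as a
  first-order equation that is Lipschitz. The second singularity is that of the arcsine integrand at
  1. In terms of the angle on the energy curve, the inverse of the sine becomes an increasing
  function on the whole line, and the sine inherits its symmetries from the circle. The constant
  \<mu> is forced: with w = -\<nu> u the system asks for \<nu> powr (q - 1) = \<mu> and \<nu> \<mu>
  = lam, and (p - 1) (q - 1) = 1 turns this into \<mu> powr p = lam. A solution of amplitude c
  carries the factor c powr (2 - q) in \<mu>, hence c powr (p - q) in lam. This factor is constant
  in c exactly when p = 2, the case that the uniqueness statement excludes.\<close>

lemma signed_pow_0 [simp]: "signed_pow a 0 = 0"
  by (simp add: signed_pow_def)

lemma signed_pow_minus [simp]: "signed_pow a (- x) = - signed_pow a x"
  by (simp add: signed_pow_def)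

lemma signed_pow_one [simp]: "signed_pow 1 x = x"
  by (simp add: signed_pow_def sgn_if)

lemma signed_pow_pos: "0 < x \<Longrightarrow> signed_pow a x = x powr a"
  by (simp add: signed_pow_def)

lemma abs_signed_pow: "\<bar>signed_pow a x\<bar> = \<bar>x\<bar> powr a"
  by (simp add: signed_pow_def abs_mult sgn_if)

lemma sgn_signed_pow [simp]: "sgn (signed_pow a x) = sgn x"
  by (simp add: signed_pow_def sgn_if)

lemma signed_pow_signed_pow: "signed_pow a (signed_pow b x) = signed_pow (a * b) x"
  by (simp add: signed_pow_def[of a] abs_signed_pow powr_powr)
    (simp add: signed_pow_def mult.commute)

lemma signed_pow_mult: "signed_pow a (x * y) = signed_pow a x * signed_pow a y"
  by (simp add: signed_pow_def sgn_mult abs_mult powr_mult)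

lemma signed_pow_mono:
  assumes "0 \<le> a" "x \<le> y"
  shows "signed_pow a x \<le> signed_pow a y"
proof -
  consider "0 < x" | "x \<le> 0" "0 \<le> y" | "y < 0" using assms by linarith
  then show ?thesis
  proof cases
    case 1 then show ?thesis using assms by (simp add: signed_pow_pos powr_mono2)
  next
    case 2
    then have "signed_pow a x \<le> 0" "0 \<le> signed_pow a y" by (auto simp: signed_pow_def sgn_if)
    then show ?thesis by linarith
  next
    case 3 then show ?thesis using assms by (simp add: signed_pow_def powr_mono2)
  qed
qed

lemma mult_signed_pow: "x * signed_pow (a - 1) x = \<bar>x\<bar> powr a"
  by (cases "x = 0") (auto simp: signed_pow_def sgn_if powr_diff)

lemma isCont_signed_pow:
  assumes "0 < a"
  shows "isCont (signed_pow a) x"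
proof -
  \<comment> \<open>Splitting into positive and negative part leaves powers of nonnegative bases,
    which are continuous at 0 for a positive exponent.\<close>
  have eq: "signed_pow a = (\<lambda>x. (max x 0) powr a - (max (- x) 0) powr a)"
    by (rule ext) (simp add: signed_pow_def sgn_if max_def)
  show ?thesis unfolding eq isCont_def
    by (intro tendsto_intros) (use assms in \<open>auto intro!: always_eventually\<close>)
qed

lemma continuous_on_signed_pow [continuous_intros]:
  assumes "0 < a" "continuous_on A f"
  shows "continuous_on A (\<lambda>x. signed_pow a (f x))"
  by (rule continuous_on_compose2[of UNIV "signed_pow a", OF _ assms(2)])
    (auto intro: continuous_at_imp_continuous_on isCont_signed_pow assms)

lemma DERIV_signed_pow:
  assumes "x \<noteq> 0"
  shows "(signed_pow a has_real_derivative a * \<bar>x\<bar> powr (a - 1)) (at x)"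
proof (cases "0 < x")
  case True
  have "((\<lambda>x. x powr a) has_real_derivative a * \<bar>x\<bar> powr (a - 1)) (at x)"
    using has_real_derivative_powr[OF True, of a] True by simp
  then show ?thesis
    by (rule DERIV_cong_ev[THEN iffD1, rotated 3])
      (use True in \<open>auto intro!: eventually_mono[OF eventually_nhds_in_open[of "{0<..}" x]]
        simp: signed_pow_pos\<close>)
next
  case False
  with assms have neg: "x < 0" by simp
  have "((\<lambda>x. - ((- x) powr a)) has_real_derivative a * \<bar>x\<bar> powr (a - 1)) (at x)"
    by (rule derivative_eq_intros refl | use neg in simp)+
  then show ?thesis
    by (rule DERIV_cong_ev[THEN iffD1, rotated 3])
      (use neg in \<open>auto intro!: eventually_mono[OF eventually_nhds_in_open[of "{..<0}" x]]
        simp: signed_pow_def\<close>)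
qed

lemma DERIV_abs_powr:
  assumes "1 < a"
  shows "((\<lambda>x. \<bar>x\<bar> powr a) has_real_derivative a * signed_pow (a - 1) x) (at x)"
proof (cases "x = 0")
  case True
  \<comment> \<open>At 0 the difference quotient is itself a signed power, and it tends to 0 because
    a > 1. For h = 0 both sides are 0 by the convention for division.\<close>
  have eq: "(\<bar>0 + h\<bar> powr a - \<bar>0\<bar> powr a) / h = signed_pow (a - 1) h" for h :: real
    using mult_signed_pow[of h a] by (cases "h = 0") (auto simp: field_simps)
  have "(signed_pow (a - 1) \<longlongrightarrow> 0) (at 0)"
    using isCont_signed_pow[of "a - 1" 0] assms by (simp add: isCont_def)
  then show ?thesis unfolding True DERIV_def eq by simp
next
  case False
  have eq: "(\<lambda>x. \<bar>x\<bar> powr a) = (\<lambda>x. x * signed_pow (a - 1) x)"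
    by (simp add: mult_signed_pow)
  have "\<bar>x\<bar> powr (a - 1 - 1) * x = signed_pow (a - 1) x"
    using False powr_mult_base[of "\<bar>x\<bar>" "a - 1 - 1"]
    by (auto simp: signed_pow_def sgn_if mult.commute)
  then have "a * signed_pow (a - 1) x = 1 * signed_pow (a - 1) x + ((a - 1) * \<bar>x\<bar> powr (a - 1 - 1)) * x"
    by (simp add: algebra_simps)
  then show ?thesis unfolding eq
    using DERIV_mult[OF DERIV_ident DERIV_signed_pow[OF False, of "a - 1"]] by metis
qed

section \<open>Differentiation across exceptional points, and antiderivatives on the line\<close>

lemma has_real_derivative_transform_on:
  assumes "(f has_real_derivative D) (at x within A)" "x \<in> A" "\<And>y. y \<in> A \<Longrightarrow> g y = f y"
  shows "(g has_real_derivative D) (at x within A)"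
  using has_derivative_transform[OF assms(2,3)] assms(1) by (simp add: has_field_derivative_def)

text \<open>The fundamental theorem tolerates finitely many exceptional points, so f is a constant
  plus the integral of the continuous function g, and that integral is differentiable everywhere.
  This gives derivatives at points where the chain rule breaks down.\<close>

lemma DERIV_at_exceptional_points:
  fixes f g :: "real \<Rightarrow> real"
  assumes "finite S" "continuous_on {a..b} f" "continuous_on {a..b} g"
    and der: "\<And>y. y \<in> {a<..<b} - S \<Longrightarrow> (f has_real_derivative g y) (at y)"
    and x: "x \<in> {a<..<b}"
  shows "(f has_real_derivative g x) (at x)"
proof -
  have int: "integral {a..y} g = f y - f a" if "y \<in> {a..b}" for y
  proof (rule integral_unique, rule fundamental_theorem_of_calculus_interior_strong[OF \<open>finite S\<close>])
    show "continuous_on {a..y} f" using assms(2) that by (auto intro: continuous_on_subset)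
  qed (use that der in \<open>auto simp: has_real_derivative_iff_has_vector_derivative[symmetric]\<close>)
  have "((\<lambda>y. integral {a..y} g) has_real_derivative g x) (at x within {a..b})"
    by (rule integral_has_real_derivative) (use assms in auto)
  then have "((\<lambda>y. integral {a..y} g + f a) has_real_derivative g x) (at x within {a..b})"
    by (auto intro!: derivative_eq_intros)
  then have "(f has_real_derivative g x) (at x within {a..b})"
    by (rule has_real_derivative_transform_on) (use int x in auto)
  then show ?thesis using x at_within_Icc_at[of a x b] by simp
qed

text \<open>For x < 0 the first interval is empty and for x > 0 the second, so the difference is the
  oriented integral from 0 to x.\<close>

lemma antiderivative_on_UNIV:
  fixes f :: "real \<Rightarrow> real"
  assumes "continuous_on UNIV f"
  shows "((\<lambda>x. integral {0..x} f - integral {x..0} f) has_real_derivative f x) (at x)"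
proof -
  \<comment> \<open>An interval that contains 0 and has x in its interior, so that the derivative
    within it is a full derivative.\<close>
  define a where "a = - \<bar>x\<bar> - 1"
  define b where "b = \<bar>x\<bar> + 1"
  have a0: "a \<le> 0" unfolding a_def by simp
  have cont: "continuous_on A f" for A using assms by (rule continuous_on_subset) simp
  have eq: "integral {a..y} f - integral {a..0} f = integral {0..y} f - integral {y..0} f"
    if "y \<in> {a..b}" for y
  proof (cases "0 \<le> y")
    case True
    have "integral {y..0} f = 0" using True by (cases "y = 0") simp_all
    with Henstock_Kurzweil_Integration.integral_combine[OF a0 True integrable_continuous_real[OF cont]]
    show ?thesis by linarith
  next
    case False
    then have "integral {0..y} f = 0" "a \<le> y" "y \<le> 0" using that by simp_all
    with Henstock_Kurzweil_Integration.integral_combine[OF _ _ integrable_continuous_real[OF cont], of a y 0]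
    show ?thesis by linarith
  qed
  have x: "x \<in> {a<..<b}" unfolding a_def b_def by auto
  have "continuous_on {a..b} f" "x \<in> {a..b}" using cont x by simp_all
  from DERIV_diff[OF integral_has_real_derivative[OF this] DERIV_const[of "integral {a..0} f"]]
  have "((\<lambda>y. integral {a..y} f - integral {a..0} f) has_real_derivative f x) (at x within {a..b})"
    by simp
  then have "((\<lambda>y. integral {0..y} f - integral {y..0} f) has_real_derivative f x) (at x within {a..b})"
    by (rule has_real_derivative_transform_on) (use x in simp, rule eq[symmetric])
  then show ?thesis using x at_within_Icc_at[of a x b] by simp
qed

section \<open>The generalized sine function\<close>

definition sin_power_integral :: "real \<Rightarrow> real \<Rightarrow> real" where
  "sin_power_integral a x =
     integral {0..x} (\<lambda>t. \<bar>sin t\<bar> powr a) - integral {x..0} (\<lambda>t. \<bar>sin t\<bar> powr a)"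

text \<open>\<open>gtime q x\<close> is the improper integral of \<open>2 / q * \<bar>sin\<bar> powr (2 / q - 1)\<close> over \<open>{0..x}\<close>.
  Integration by parts has made the integrand continuous also for \<open>q > 2\<close>.\<close>

definition gtime :: "real \<Rightarrow> real \<Rightarrow> real" where
  "gtime q x = signed_pow (2 / q) (sin x) * cos x + (2 / q + 1) * sin_power_integral (2 / q + 1) x"

definition gangle :: "real \<Rightarrow> real \<Rightarrow> real" where
  "gangle q = inv (gtime q)"

text \<open>The curve \<open>\<bar>x\<bar> powr q + y\<^sup>2 = 1\<close> is parametrised by an angle \<open>\<theta>\<close> with
  \<open>sgn x * \<bar>x\<bar> powr (q / 2) = sin \<theta>\<close> and \<open>y = cos \<theta>\<close>; the function \<open>gsin q\<close> below
  turns out to be \<open>sin_rs 2 q\<close>, with derivative \<open>gcos q\<close>.\<close>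

definition gsin :: "real \<Rightarrow> real \<Rightarrow> real" where
  "gsin q t = signed_pow (2 / q) (sin (gangle q t))"

definition gcos :: "real \<Rightarrow> real \<Rightarrow> real" where
  "gcos q t = cos (gangle q t)"

lemma DERIV_sin_power_integral:
  assumes "0 < a"
  shows "(sin_power_integral a has_real_derivative \<bar>sin x\<bar> powr a) (at x)"
proof -
  have "continuous_on UNIV (\<lambda>t::real. \<bar>sin t\<bar> powr a)"
    by (intro continuous_on_powr' continuous_intros) (use assms in auto)
  from antiderivative_on_UNIV[OF this] show ?thesis
    unfolding sin_power_integral_def[abs_def] .
qed

lemma sin_power_integral_0 [simp]: "sin_power_integral a 0 = 0"
  by (simp add: sin_power_integral_def)

lemma sin_power_integral_minus:
  assumes "0 < a"
  shows "sin_power_integral a (- x) = - sin_power_integral a x"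
proof -
  have "((\<lambda>x. sin_power_integral a x + sin_power_integral a (- x)) has_real_derivative 0) (at x)" for x
    by (rule derivative_eq_intros DERIV_chain2[OF DERIV_sin_power_integral] DERIV_sin_power_integral
        assms refl | simp)+
  then have "sin_power_integral a x + sin_power_integral a (- x)
      = sin_power_integral a 0 + sin_power_integral a (- 0)"
    by (intro DERIV_isconst_all) blast
  then show ?thesis by simp
qed

text \<open>The absolute value of the sine has period pi, so the difference has derivative 0. This
  is the source of the half-period of \<open>gsin\<close>.\<close>

lemma sin_power_integral_plus_pi:
  assumes "0 < a"
  shows "sin_power_integral a (x + pi) = sin_power_integral a x + sin_power_integral a pi"
proof -
  have "((\<lambda>x. sin_power_integral a (x + pi) - sin_power_integral a x) has_real_derivative 0) (at x)" for x
    by (rule derivative_eq_intros DERIV_chain2[OF DERIV_sin_power_integral] DERIV_sin_power_integral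
        assms refl | simp)+
  then have "sin_power_integral a (x + pi) - sin_power_integral a x
      = sin_power_integral a (0 + pi) - sin_power_integral a 0"
    by (intro DERIV_isconst_all) blast
  then show ?thesis by simp
qed

lemma gtime_0 [simp]: "gtime q 0 = 0"
  by (simp add: gtime_def)

lemma gtime_minus: "1 < q \<Longrightarrow> gtime q (- x) = - gtime q x"
  by (simp add: gtime_def sin_power_integral_minus add_pos_pos)

lemma gtime_plus_pi: "1 < q \<Longrightarrow> gtime q (x + pi) = gtime q x + gtime q pi"
  using sin_power_integral_plus_pi[of "2 / q + 1" x]
  by (simp add: gtime_def add_pos_pos distrib_left)

lemma gtime_pi_minus: "1 < q \<Longrightarrow> gtime q (pi - x) = gtime q pi - gtime q x"
  using gtime_plus_pi[of q "- x"] gtime_minus[of q x] by simp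

lemma gtime_pi_half: "1 < q \<Longrightarrow> gtime q (pi / 2) = gtime q pi / 2"
  using gtime_pi_minus[of q "pi / 2"] by simp

lemma isCont_gtime: "1 < q \<Longrightarrow> isCont (gtime q) x"
  unfolding gtime_def[abs_def]
  by (intro continuous_intros DERIV_isCont[OF DERIV_sin_power_integral]
      isCont_o2[OF _ isCont_signed_pow] isCont_sin)
    (auto intro: add_pos_pos)

text \<open>The product rule produces three terms that \<open>sin\<^sup>2 + cos\<^sup>2 = 1\<close>
  collapses to the original integrand, undoing the integration by parts behind
  \<open>gtime\<close>.\<close>

lemma DERIV_gtime:
  assumes "1 < q" "sin x \<noteq> 0"
  shows "(gtime q has_real_derivative 2 / q * \<bar>sin x\<bar> powr (2 / q - 1)) (at x)"
proof -
  define b where "b = 2 / q"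
  have b: "0 < b" using assms by (simp add: b_def)
  have "((\<lambda>x. signed_pow b (sin x) * cos x + (b + 1) * sin_power_integral (b + 1) x)
      has_real_derivative
        (b * \<bar>sin x\<bar> powr (b - 1) * cos x) * cos x + (- sin x) * signed_pow b (sin x)
          + (b + 1) * \<bar>sin x\<bar> powr (b + 1)) (at x)"
    by (intro DERIV_add DERIV_mult DERIV_cmult DERIV_sin_power_integral DERIV_cos
        DERIV_chain2[OF DERIV_signed_pow DERIV_sin]) (use b assms in auto)
  moreover have "(b * \<bar>sin x\<bar> powr (b - 1) * cos x) * cos x + (- sin x) * signed_pow b (sin x)
          + (b + 1) * \<bar>sin x\<bar> powr (b + 1) = b * \<bar>sin x\<bar> powr (b - 1)"
  proof -
    have e1: "sin x * signed_pow b (sin x) = \<bar>sin x\<bar> powr (b + 1)"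
      using mult_signed_pow[of "sin x" "b + 1"] by simp
    have "\<bar>sin x\<bar> powr (b + 1) = \<bar>sin x\<bar> powr (b - 1) * \<bar>sin x\<bar> powr 2"
      unfolding powr_add[symmetric] by (rule arg_cong2[where f = "(powr)"]) simp_all
    then have e2: "\<bar>sin x\<bar> powr (b + 1) = \<bar>sin x\<bar> powr (b - 1) * (sin x)\<^sup>2"
      using assms by simp
    have "(b * \<bar>sin x\<bar> powr (b - 1) * cos x) * cos x + (- sin x) * signed_pow b (sin x)
          + (b + 1) * \<bar>sin x\<bar> powr (b + 1)
        = b * \<bar>sin x\<bar> powr (b - 1) * (cos x)\<^sup>2 - sin x * signed_pow b (sin x)
          + (b + 1) * \<bar>sin x\<bar> powr (b + 1)"
      by (simp add: power2_eq_square)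
    also have "\<dots> = b * \<bar>sin x\<bar> powr (b - 1) * ((sin x)\<^sup>2 + (cos x)\<^sup>2)"
      unfolding e1 e2 by algebra
    finally show ?thesis by simp
  qed
  ultimately show ?thesis unfolding gtime_def[abs_def] b_def by simp
qed

lemma finite_sin_zeros:
  fixes a b :: real
  shows "finite {x \<in> {a..b}. sin x = 0}"
proof (rule finite_subset)
  show "{x \<in> {a..b}. sin x = 0} \<subseteq> (\<lambda>k. of_int k * pi) ` {\<lfloor>a / pi\<rfloor>..\<lceil>b / pi\<rceil>}"
  proof
    fix x assume "x \<in> {x \<in> {a..b}. sin x = 0}"
    then obtain k :: int where k: "x = of_int k * pi" "a \<le> x" "x \<le> b"
      by (auto simp: sin_zero_iff_int2)
    then have "a / pi \<le> of_int k" "of_int k \<le> b / pi" by (simp_all add: field_simps)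
    then have "\<lfloor>a / pi\<rfloor> \<le> k" "k \<le> \<lceil>b / pi\<rceil>" by linarith+
    with k show "x \<in> (\<lambda>k. of_int k * pi) ` {\<lfloor>a / pi\<rfloor>..\<lceil>b / pi\<rceil>}" by auto
  qed
qed simp

text \<open>A nonnegative integrand gives monotonicity. If the values at two points agreed,
  \<open>gtime q\<close> would be constant between them, so its derivative and with it the sine
  would vanish on a whole interval; then the cosine vanishes there too, which is impossible.\<close>

lemma strict_mono_gtime:
  assumes q: "1 < q"
  shows "strict_mono (gtime q)"
proof (rule strict_monoI)
  have mono: "gtime q x \<le> gtime q y" if "x \<le> y" for x y
  proof -
    have "((\<lambda>x. 2 / q * \<bar>sin x\<bar> powr (2 / q - 1)) has_integral gtime q y - gtime q x) {x..y}"
    proof (rule fundamental_theorem_of_calculus_interior_strong[OF finite_sin_zeros[of x y] that])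
      show "continuous_on {x..y} (gtime q)"
        using isCont_gtime[OF q] continuous_at_imp_continuous_on by blast
    qed (use DERIV_gtime[OF q] in \<open>auto simp flip: has_real_derivative_iff_has_vector_derivative\<close>)
    then have "0 \<le> gtime q y - gtime q x"
      by (rule has_integral_nonneg) (use q in auto)
    then show ?thesis by simp
  qed
  fix x y :: real assume "x < y"
  show "gtime q x < gtime q y"
  proof (rule ccontr)
    assume "\<not> gtime q x < gtime q y"
    with mono[of x y] \<open>x < y\<close> have "gtime q y = gtime q x" by simp
    then have const: "gtime q z = gtime q x" if "z \<in> {x<..<y}" for z
      using mono[of x z] mono[of z y] that by auto
    have zero: "sin z = 0" if z: "z \<in> {x<..<y}" for z
    proof (rule ccontr)
      assume "sin z \<noteq> 0"
      have "((\<lambda>_. gtime q x) has_real_derivative 2 / q * \<bar>sin z\<bar> powr (2 / q - 1)) (at z)"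
        by (rule has_field_derivative_transform_within_open[OF DERIV_gtime[OF q \<open>sin z \<noteq> 0\<close>], of "{x<..<y}"])
          (use z const in auto)
      then have "2 / q * \<bar>sin z\<bar> powr (2 / q - 1) = 0"
        using DERIV_unique DERIV_const by blast
      then show False using q \<open>sin z \<noteq> 0\<close> by simp
    qed
    define m where "m = (x + y) / 2"
    have m: "m \<in> {x<..<y}" using \<open>x < y\<close> by (simp add: m_def)
    have "((\<lambda>_. 0) has_real_derivative cos m) (at m)"
      by (rule has_field_derivative_transform_within_open[OF DERIV_sin, of "{x<..<y}"])
        (use m zero in auto)
    then have "cos m = 0" using DERIV_unique DERIV_const by blast
    then show False using zero[OF m] sin_cos_squared_add[of m] by simp
  qed
qed

lemma gtime_less_iff: "1 < q \<Longrightarrow> gtime q x < gtime q y \<longleftrightarrow> x < y"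
  by (rule strict_mono_less[OF strict_mono_gtime])

lemma gtime_le_iff: "1 < q \<Longrightarrow> gtime q x \<le> gtime q y \<longleftrightarrow> x \<le> y"
  by (rule strict_mono_less_eq[OF strict_mono_gtime])

lemma gtime_pi_pos: "1 < q \<Longrightarrow> 0 < gtime q pi"
  using gtime_less_iff[of q 0 pi] by simp

lemma gtime_of_nat_pi: "1 < q \<Longrightarrow> gtime q (real n * pi) = real n * gtime q pi"
  by (induction n) (simp_all add: distrib_right gtime_plus_pi add.commute[of pi] add.commute[of "gtime q pi"])

lemma surj_gtime:
  assumes q: "1 < q"
  shows "surj (gtime q)"
  unfolding surj_def
proof
  fix y
  \<comment> \<open>\<open>gtime q\<close> grows by \<open>gtime q pi\<close> over each half turn,
    so n half turns in either direction enclose y.\<close>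
  obtain n :: nat where "\<bar>y\<bar> / gtime q pi < real n" using reals_Archimedean2 by blast
  then have n: "\<bar>y\<bar> \<le> real n * gtime q pi" using gtime_pi_pos[OF q] by (simp add: field_simps)
  have "\<exists>x\<ge>- (real n * pi). x \<le> real n * pi \<and> gtime q x = y"
    by (rule IVT) (use n q in \<open>auto simp: gtime_minus gtime_of_nat_pi isCont_gtime\<close>)
  then show "\<exists>x. y = gtime q x" by blast
qed

section \<open>The inverse of \<open>gtime\<close> and the differential equations for
  \<open>gsin\<close> and \<open>gcos\<close>\<close>

context
  fixes q :: real
  assumes q: "1 < q"
begin

lemma gtime_gangle [simp]: "gtime q (gangle q t) = t"
  unfolding gangle_def by (rule surj_f_inv_f[OF surj_gtime[OF q]])

lemma gangle_gtime [simp]: "gangle q (gtime q x) = x"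
  unfolding gangle_def by (rule inv_f_f[OF strict_mono_imp_inj_on[OF strict_mono_gtime[OF q]]])

lemma gangle_eqI: "gtime q x = t \<Longrightarrow> gangle q t = x"
  by auto

lemma gangle_less_iff: "gangle q s < x \<longleftrightarrow> s < gtime q x" "x < gangle q s \<longleftrightarrow> gtime q x < s"
  using gtime_less_iff[OF q, of "gangle q s" x] gtime_less_iff[OF q, of x "gangle q s"] by simp_all

lemma gangle_0 [simp]: "gangle q 0 = 0"
  by (rule gangle_eqI) simp

lemma gangle_minus: "gangle q (- t) = - gangle q t"
  by (rule gangle_eqI) (simp add: gtime_minus q)

lemma gangle_plus: "gangle q (t + gtime q pi) = gangle q t + pi"
  by (rule gangle_eqI) (simp add: gtime_plus_pi q)

lemma gangle_refl: "gangle q (gtime q pi - t) = pi - gangle q t"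
  by (rule gangle_eqI) (simp add: gtime_pi_minus q)

lemma isCont_gangle: "isCont (gangle q) t"
  using isCont_inverse_function[of 1 "gangle q t" "gangle q" "gtime q"] isCont_gtime[OF q] by simp

lemma isCont_gsin: "isCont (gsin q) t"
  unfolding gsin_def[abs_def]
  by (intro isCont_o2[OF _ isCont_signed_pow] isCont_o2[OF isCont_gangle] isCont_sin) (use q in auto)

lemma isCont_gcos: "isCont (gcos q) t"
  unfolding gcos_def[abs_def] by (intro isCont_o2[OF isCont_gangle] isCont_cos)

lemma gsin_0 [simp]: "gsin q 0 = 0" and gcos_0 [simp]: "gcos q 0 = 1"
  by (simp_all add: gsin_def gcos_def)

lemma gsin_minus: "gsin q (- t) = - gsin q t"
  by (simp add: gsin_def gangle_minus)

lemma gsin_plus: "gsin q (t + gtime q pi) = - gsin q t"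
  by (simp add: gsin_def gangle_plus)

lemma gsin_refl: "gsin q (gtime q pi - t) = gsin q t"
  by (simp add: gsin_def gangle_refl)

lemma abs_gsin_le: "\<bar>gsin q t\<bar> \<le> 1"
  unfolding gsin_def abs_signed_pow using q by (intro powr_le1) auto

lemma DERIV_gangle:
  assumes "sin (gangle q t) \<noteq> 0"
  shows "(gangle q has_real_derivative inverse (2 / q * \<bar>sin (gangle q t)\<bar> powr (2 / q - 1))) (at t)"
  by (rule DERIV_inverse_function[where f = "gtime q" and a = "t - 1" and b = "t + 1"])
    (use q assms DERIV_gtime isCont_gangle in auto)

text \<open>The window is one radian to each side in the angle, less than pi. At a zero of the sine
  the addition formula leaves cos times sin h, with both factors nonzero.\<close>

lemma sin_gangle_isolated_zero:
  assumes "sin (gangle q t) = 0"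
    and "y \<in> {gtime q (gangle q t - 1)<..<gtime q (gangle q t + 1)} - {t}"
  shows "sin (gangle q y) \<noteq> 0"
proof -
  define h where "h = gangle q y - gangle q t"
  have "h \<noteq> 0"
  proof
    assume "h = 0"
    then have "gtime q (gangle q y) = gtime q (gangle q t)" by (simp add: h_def)
    with assms(2) show False by simp
  qed
  moreover have "\<bar>h\<bar> < 1" using assms(2) by (auto simp: h_def gangle_less_iff[symmetric])
  ultimately have "sin h \<noteq> 0"
    using sin_gt_zero[of h] sin_gt_zero[of "- h"] pi_gt3 by (cases "0 < h") auto
  moreover have "cos (gangle q t) \<noteq> 0" using assms(1) sin_cos_squared_add[of "gangle q t"] by auto
  moreover have "sin (gangle q y) = cos (gangle q t) * sin h"
    using sin_add[of "gangle q t" h] assms(1) by (simp add: h_def)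
  ultimately show ?thesis by simp
qed

text \<open>Where the sine vanishes, the speed \<open>\<bar>sin x\<bar> powr (2 / q - 1)\<close> of
  \<open>gtime\<close> degenerates to 0 or infinity unless q = 2, and \<open>gangle\<close> cannot
  be differentiated by the inverse rule. Such times are isolated, so continuity of f and of the
  candidate derivative bridges them.\<close>

lemma DERIV_by_gangle:
  assumes "\<And>t. isCont f t" "\<And>t. isCont g t"
    and der: "\<And>t. sin (gangle q t) \<noteq> 0 \<Longrightarrow> (f has_real_derivative g t) (at t)"
  shows "(f has_real_derivative g t) (at t)"
proof (cases "sin (gangle q t) = 0")
  case True
  show ?thesis
  proof (rule DERIV_at_exceptional_points[of "{t}" "gtime q (gangle q t - 1)" "gtime q (gangle q t + 1)"])
    show "t \<in> {gtime q (gangle q t - 1)<..<gtime q (gangle q t + 1)}"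
      by (auto simp: gangle_less_iff[symmetric])
  qed (use assms sin_gangle_isolated_zero[OF True] in \<open>auto intro!: continuous_at_imp_continuous_on\<close>)
qed (rule der)

text \<open>The speed of \<open>gtime\<close> is exactly the derivative factor of
  \<open>signed_pow (2 / q)\<close>, so it cancels against the derivative of \<open>gangle\<close>
  and only the cosine remains.\<close>

lemma DERIV_gsin: "(gsin q has_real_derivative gcos q t) (at t)"
proof (rule DERIV_by_gangle[OF isCont_gsin isCont_gcos])
  fix t assume *: "sin (gangle q t) \<noteq> 0"
  have "(gsin q has_real_derivative 2 / q * \<bar>sin (gangle q t)\<bar> powr (2 / q - 1) *
      (cos (gangle q t) * inverse (2 / q * \<bar>sin (gangle q t)\<bar> powr (2 / q - 1)))) (at t)"
    unfolding gsin_def[abs_def]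
    by (rule DERIV_chain2[OF DERIV_signed_pow[OF *] DERIV_chain2[OF DERIV_sin DERIV_gangle[OF *]]])
  then show "(gsin q has_real_derivative gcos q t) (at t)"
    using q * by (simp add: gcos_def field_simps)
qed

text \<open>With \<open>DERIV_gsin\<close> this is the model equation for unit amplitude and
  frequency; its coefficient q / 2 is the one that reappears in the eigenvalues.\<close>

lemma DERIV_gcos: "(gcos q has_real_derivative - (q / 2) * signed_pow (q - 1) (gsin q t)) (at t)"
proof (rule DERIV_by_gangle[OF isCont_gcos])
  fix t
  show "isCont (\<lambda>t. - (q / 2) * signed_pow (q - 1) (gsin q t)) t"
    by (intro continuous_intros isCont_o2[OF isCont_gsin isCont_signed_pow]) (use q in auto)
  assume *: "sin (gangle q t) \<noteq> 0"
  define s where "s = sin (gangle q t)"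
  have s: "s \<noteq> 0" using * by (simp add: s_def)
  have "(gcos q has_real_derivative - s * inverse (2 / q * \<bar>s\<bar> powr (2 / q - 1))) (at t)"
    unfolding gcos_def[abs_def] s_def
    by (rule DERIV_chain2[OF DERIV_cos DERIV_gangle[OF *]])
  moreover have "- s * inverse (2 / q * \<bar>s\<bar> powr (2 / q - 1)) = - (q / 2) * signed_pow (q - 1) (gsin q t)"
  proof -
    have e: "(q - 1) * (2 / q) = 1 - (2 / q - 1)" using q by (simp add: field_simps)
    have "signed_pow (q - 1) (gsin q t) = sgn s * (\<bar>s\<bar> powr (1 - (2 / q - 1)))"
      unfolding gsin_def signed_pow_signed_pow e s_def[symmetric] by (simp add: signed_pow_def)
    also have "\<dots> = s / \<bar>s\<bar> powr (2 / q - 1)"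
      using s by (simp only: powr_diff) (auto simp: sgn_if)
    finally show ?thesis using q s by (simp add: field_simps)
  qed
  ultimately show "(gcos q has_real_derivative - (q / 2) * signed_pow (q - 1) (gsin q t)) (at t)"
    by (rule DERIV_cong)
qed

end

section \<open>Identification of \<open>gsin\<close> and \<open>gtime q pi\<close> with
  \<open>sin_rs\<close> and \<open>pi_rs\<close>\<close>

context
  fixes q :: real
  assumes q: "1 < q"
begin

text \<open>The substitution \<tau> powr (q / 2) = sin \<theta> turns the integrand into the
  derivative of \<open>gtime\<close>. The antiderivative is continuous up to y = 1, so the
  singularity there is absorbed by taking derivatives in the interior only.\<close>

lemma arcsin_rs_2:
  assumes y: "y \<in> {0..1}"
  shows "arcsin_rs 2 q y = gtime q (arcsin (y powr (q / 2)))"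
proof -
  have "((\<lambda>\<tau>. 1 / (1 - \<tau> powr q) powr (1 / 2)) has_integral
      gtime q (arcsin (y powr (q / 2))) - gtime q (arcsin (0 powr (q / 2)))) {0..y}"
  proof (rule fundamental_theorem_of_calculus_interior)
    have le: "x powr (q / 2) \<le> 1" if "x \<in> {0..y}" for x
      using that y q by (intro powr_le1) auto
    have "continuous_on {0..y} (\<lambda>x. arcsin (x powr (q / 2)))"
    proof (intro continuous_on_arcsin continuous_on_powr' continuous_intros)
      show "\<forall>x\<in>{0..y}. - 1 \<le> x powr (q / 2) \<and> x powr (q / 2) \<le> 1"
        using le by (auto intro: order_trans[OF _ powr_ge_zero])
    qed (use q in auto)
    then show "continuous_on {0..y} (\<lambda>x. gtime q (arcsin (x powr (q / 2))))"
      by (rule continuous_on_compose2[OF continuous_at_imp_continuous_on, of UNIV, rotated])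
        (auto intro: isCont_gtime[OF q])
    fix x assume x: "x \<in> {0<..<y}"
    define z where "z = x powr (q / 2)"
    have x01: "0 < x" "x < 1" using x y by auto
    then have z: "0 < z" "z < 1"
      using q powr_less_mono2[of "q / 2" x 1] by (auto simp: z_def)
    have sz: "sin (arcsin z) = z" using z by simp
    have "((\<lambda>x. gtime q (arcsin (x powr (q / 2)))) has_real_derivative
        2 / q * \<bar>sin (arcsin z)\<bar> powr (2 / q - 1) *
          (inverse (sqrt (1 - z\<^sup>2)) * (q / 2 * x powr (q / 2 - 1)))) (at x)"
      unfolding z_def
      by (rule DERIV_chain2[OF DERIV_gtime[OF q] DERIV_chain2[OF DERIV_arcsin has_real_derivative_powr]])
        (use z x01 in \<open>auto simp flip: z_def\<close>)
    moreover have "2 / q * \<bar>sin (arcsin z)\<bar> powr (2 / q - 1) *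
          (inverse (sqrt (1 - z\<^sup>2)) * (q / 2 * x powr (q / 2 - 1)))
        = 1 / (1 - x powr q) powr (1 / 2)"
    proof -
      have "z powr (2 / q - 1) = x powr (1 - q / 2)"
        using q by (simp add: z_def powr_powr right_diff_distrib)
      then have e: "z powr (2 / q - 1) * x powr (q / 2 - 1) = 1"
        using x01 by (simp flip: powr_add)
      have z2: "z\<^sup>2 = x powr q" by (simp add: z_def power2_eq_square flip: powr_add)
      have "x powr q < 1" using z2 z by (simp flip: z2 add: power_less_one_iff)
      then have sq: "sqrt (1 - z\<^sup>2) = (1 - x powr q) powr (1 / 2)"
        by (simp add: z2 powr_half_sqrt)
      have "2 / q * \<bar>sin (arcsin z)\<bar> powr (2 / q - 1) *
          (inverse (sqrt (1 - z\<^sup>2)) * (q / 2 * x powr (q / 2 - 1)))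
        = (z powr (2 / q - 1) * x powr (q / 2 - 1)) * inverse (sqrt (1 - z\<^sup>2))"
        unfolding sz using q z by simp
      then show ?thesis unfolding e sq by (simp add: inverse_eq_divide)
    qed
    ultimately show "((\<lambda>x. gtime q (arcsin (x powr (q / 2)))) has_vector_derivative
        1 / (1 - x powr q) powr (1 / 2)) (at x)"
      by (simp add: has_real_derivative_iff_has_vector_derivative)
  qed (use y in auto)
  then show ?thesis by (simp add: arcsin_rs_def integral_unique)
qed

lemma pi_rs_2: "pi_rs 2 q = gtime q pi"
proof -
  have "pi_rs 2 q = 2 * arcsin_rs 2 q 1" by (simp add: pi_rs_def arcsin_rs_def)
  also have "\<dots> = gtime q pi" by (simp add: arcsin_rs_2 gtime_pi_half q)
  finally show ?thesis .
qed

text \<open>Here the substitution is \<tau> = cos \<theta>: the integrand becomes a power of the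
  sine with exponent 2 / q - 2, which is - 2 / p precisely for conjugate exponents. This relation
  links the two forms of the eigenvalue.\<close>

lemma pi_rs_to_2:
  assumes p: "1 / p + 1 / q = 1"
  shows "pi_rs p 2 = q / 2 * gtime q pi"
proof -
  have "((\<lambda>\<tau>. 1 / (1 - \<tau> powr 2) powr (1 / p)) has_integral
      - (q / 2) * gtime q (arccos 1) - - (q / 2) * gtime q (arccos 0)) {0..1}"
  proof (rule fundamental_theorem_of_calculus_interior)
    have "continuous_on {0..1} (\<lambda>x. gtime q (arccos x))"
      by (rule continuous_on_compose2[OF continuous_at_imp_continuous_on, of UNIV _ _ arccos])
        (auto intro!: continuous_intros isCont_gtime[OF q])
    then show "continuous_on {0..1} (\<lambda>x. - (q / 2) * gtime q (arccos x))"
      by (intro continuous_intros)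
    fix x :: real assume x: "x \<in> {0<..<1}"
    define s where "s = sqrt (1 - x\<^sup>2)"
    have x2: "x\<^sup>2 < 1" using x by (simp add: power_less_one_iff)
    have s: "0 < s" using x2 by (simp add: s_def)
    have ss: "sin (arccos x) = s" using x by (simp add: s_def sin_arccos)
    have "((\<lambda>x. - (q / 2) * gtime q (arccos x)) has_real_derivative
        - (q / 2) * (2 / q * \<bar>sin (arccos x)\<bar> powr (2 / q - 1) * inverse (- sqrt (1 - x\<^sup>2)))) (at x)"
      by (rule DERIV_cmult DERIV_chain2[OF DERIV_gtime[OF q] DERIV_arccos])+
        (use x ss s in auto)
    moreover have "- (q / 2) * (2 / q * \<bar>sin (arccos x)\<bar> powr (2 / q - 1) * inverse (- sqrt (1 - x\<^sup>2)))
        = 1 / (1 - x powr 2) powr (1 / p)"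
    proof -
      have "- (q / 2) * (2 / q * \<bar>sin (arccos x)\<bar> powr (2 / q - 1) * inverse (- sqrt (1 - x\<^sup>2)))
          = s powr (2 / q - 1) / s powr 1"
        unfolding ss s_def[symmetric] using q s by (simp add: field_simps)
      also have "\<dots> = s powr (2 / q - 1 - 1)" by (simp only: powr_diff)
      also have "2 / q - 1 - 1 = 2 * - (1 / p)" using p by (simp add: field_simps)
      also have "s powr (2 * - (1 / p)) = (s powr 2) powr (- (1 / p))" by (simp only: powr_powr)
      also have "s powr 2 = 1 - x powr 2" using s x x2 by (simp add: s_def)
      finally show ?thesis by (simp add: powr_minus inverse_eq_divide)
    qed
    ultimately show "((\<lambda>x. - (q / 2) * gtime q (arccos x)) has_vector_derivative
        1 / (1 - x powr 2) powr (1 / p)) (at x)"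
      by (simp add: has_real_derivative_iff_has_vector_derivative)
  qed auto
  then show ?thesis by (simp add: pi_rs_def integral_unique gtime_pi_half q)
qed

lemma gsin_gtime_arcsin:
  assumes "y \<in> {0..1}"
  shows "gsin q (gtime q (arcsin (y powr (q / 2)))) = y"
proof -
  have "y powr (q / 2) \<le> 1" using assms q by (intro powr_le1) auto
  then have "sin (arcsin (y powr (q / 2))) = y powr (q / 2)"
    by (intro sin_arcsin) (auto intro: order_trans[OF _ powr_ge_zero])
  then have "gsin q (gtime q (arcsin (y powr (q / 2)))) = signed_pow (2 / q) (y powr (q / 2))"
    by (simp add: gsin_def q)
  also have "\<dots> = y"
    using assms q by (cases "y = 0") (auto simp: signed_pow_pos powr_powr)
  finally show ?thesis .
qed

lemma gangle_quarter:
  assumes "x \<in> {0..gtime q pi / 2}"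
  shows "gangle q x \<in> {0..pi / 2}"
  using assms gangle_less_iff[OF q, of x 0] gangle_less_iff[OF q, of "pi / 2" x]
  by (auto simp: gtime_pi_half[OF q] not_less[symmetric])

lemma gsin_quarter:
  assumes x: "x \<in> {0..gtime q pi / 2}"
  shows "gsin q x \<in> {0..1}" "gtime q (arcsin (gsin q x powr (q / 2))) = x"
proof -
  have a: "gangle q x \<in> {0..pi / 2}" by (rule gangle_quarter[OF x])
  then have sin: "0 \<le> sin (gangle q x)" by (intro sin_ge_zero) auto
  then show "gsin q x \<in> {0..1}"
    using abs_gsin_le[OF q, of x] by (auto simp: gsin_def signed_pow_def)
  have "gsin q x powr (q / 2) = sin (gangle q x)"
    using sin q by (cases "sin (gangle q x) = 0") (auto simp: gsin_def signed_pow_pos powr_powr)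
  then show "gtime q (arcsin (gsin q x powr (q / 2))) = x"
    using a by (simp add: arcsin_sin q)
qed

text \<open>The definite description requires uniqueness as well: the inverse property fixes f on a
  quarter period, reflection on a half period, oddness on a full period, and periodicity on the
  line.\<close>

lemma sin_rs_2: "sin_rs 2 q = gsin q"
proof -
  define h where "h = gtime q pi"
  have h: "0 < h" using gtime_pi_pos[OF q] by (simp add: h_def)
  note refl = gsin_refl[OF q, folded h_def]
  have per: "gsin q (x + 2 * h) = gsin q x" for x
    using gsin_plus[OF q, of "x + h"] gsin_plus[OF q, of x] by (simp add: h_def add.assoc)
  have quarter: "gsin q x \<in> {0..1} \<and> arcsin_rs 2 q (gsin q x) = x" if "x \<in> {0..h / 2}" for x
    using gsin_quarter[of x] that by (simp add: arcsin_rs_2 h_def)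
  show ?thesis
    unfolding sin_rs_def pi_rs_2 h_def[symmetric]
  proof (rule the_equality, intro conjI allI ballI)
    fix x y :: real
    show "gsin q x \<in> {-1..1}" using abs_gsin_le[OF q, of x] by auto
    show "gsin q (x + 2 * h) = gsin q x" by (rule per)
    show "gsin q (- x) = - gsin q x" by (rule gsin_minus[OF q])
    show "gsin q (h / 2 + x) = gsin q (h / 2 - x)" using refl[of "h / 2 - x"] by simp
    show "gsin q x \<in> {0..1}" "arcsin_rs 2 q (gsin q x) = x" if "x \<in> {0..h / 2}"
      using quarter[OF that] by auto
    assume y: "y \<in> {0..1}"
    then show "gsin q (arcsin_rs 2 q y) = y" by (simp add: arcsin_rs_2 gsin_gtime_arcsin)
    have y1: "0 \<le> y powr (q / 2)" "y powr (q / 2) \<le> 1" using y q by (auto intro!: powr_le1)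
    have "- 1 \<le> y powr (q / 2)" using y1 by linarith
    with y1 have "0 \<le> arcsin (y powr (q / 2))" "arcsin (y powr (q / 2)) \<le> pi / 2"
      using arcsin_le_arcsin[of 0 "y powr (q / 2)"] arcsin_ubound[of "y powr (q / 2)"] by auto
    then show "arcsin_rs 2 q y \<in> {0..h / 2}"
      using y gtime_le_iff[OF q, of 0] gtime_le_iff[OF q, of _ "pi / 2"]
      by (simp add: arcsin_rs_2 h_def gtime_pi_half q)
  next
    fix f :: "real \<Rightarrow> real"
    assume f: "(\<forall>x. f x \<in> {-1..1}) \<and> (\<forall>x. f (x + 2 * h) = f x) \<and> (\<forall>x. f (- x) = - f x) \<and>
      (\<forall>x. f (h / 2 + x) = f (h / 2 - x)) \<and>
      (\<forall>x\<in>{0..h / 2}. f x \<in> {0..1} \<and> arcsin_rs 2 q (f x) = x) \<and>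
      (\<forall>y\<in>{0..1}. arcsin_rs 2 q y \<in> {0..h / 2} \<and> f (arcsin_rs 2 q y) = y)"
    have f1: "f x = gsin q x" if "x \<in> {0..h / 2}" for x
      using f quarter[OF that] by metis
    have f2: "f x = gsin q x" if "x \<in> {0..h}" for x
    proof (cases "x \<le> h / 2")
      case False
      have "f (h / 2 + (x - h / 2)) = f (h / 2 - (x - h / 2))" using f by blast
      moreover have "h / 2 + (x - h / 2) = x" "h / 2 - (x - h / 2) = h - x" by (simp_all add: field_simps)
      ultimately have "f x = f (h - x)" by (simp only:)
      also have "\<dots> = gsin q (h - x)" by (rule f1) (use False that in auto)
      finally show ?thesis by (simp add: refl)
    qed (use that f1 in auto)
    have f3: "f x = gsin q x" if "x \<in> {-h..h}" for x
    proof (cases "0 \<le> x")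
      case False
      then have "f (- x) = gsin q (- x)" using that by (intro f2) auto
      then show ?thesis using f by (simp add: gsin_minus q)
    qed (use that f2 in auto)
    \<comment> \<open>Stated for an arbitrary g because it is applied to f and to
      \<open>gsin q\<close>.\<close>
    have shift: "g (x + of_int k * (2 * h)) = g x" if "\<And>x. g (x + 2 * h) = g x" for g :: "real \<Rightarrow> real" and x k
    proof (induction k rule: int_induct[where k = 0])
      case (step1 k)
      then show ?case using that[of "x + of_int k * (2 * h)"] by (simp add: algebra_simps)
    next
      case (step2 k)
      then show ?case using that[of "x + of_int (k - 1) * (2 * h)"] by (simp add: algebra_simps)
    qed simp
    show "f = gsin q"
    proof
      fix x
      \<comment> \<open>The number of full periods that brings x into
        \<open>{-h..h}\<close>.\<close>
      define k where "k = \<lfloor>(x + h) / (2 * h)\<rfloor>"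
      define y where "y = x - of_int k * (2 * h)"
      have "of_int k \<le> (x + h) / (2 * h)" "(x + h) / (2 * h) < of_int k + 1"
        unfolding k_def by linarith+
      then have "of_int k * (2 * h) \<le> x + h" "x + h < (of_int k + 1) * (2 * h)"
        using h by (simp_all add: field_simps)
      then have y: "y \<in> {-h..h}" by (auto simp: y_def algebra_simps)
      have x: "x = y + of_int k * (2 * h)" by (simp add: y_def)
      have "f x = f y" unfolding x by (rule shift) (use f in blast)
      also have "\<dots> = gsin q y" by (rule f3[OF y])
      also have "\<dots> = gsin q x" unfolding x by (rule shift[of "gsin q", symmetric]) (rule per)
      finally show "f x = gsin q x" .
    qed
  qed
qed

end

section \<open>The second-order equation\<close>

text \<open>The derivatives are taken within a larger set S, so that hypotheses on the whole
  interval serve comparisons on its subintervals.\<close>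

lemma DERIV_nonneg_imp_le_within:
  fixes f :: "real \<Rightarrow> real"
  assumes "a \<le> b" "{a..b} \<subseteq> S"
    and der: "\<And>t. t \<in> {a..b} \<Longrightarrow> (f has_real_derivative f' t) (at t within S)"
    and nonneg: "\<And>t. t \<in> {a..b} \<Longrightarrow> 0 \<le> f' t"
  shows "f a \<le> f b"
proof (rule DERIV_nonneg_imp_increasing_open[OF \<open>a \<le> b\<close>])
  have der': "(f has_real_derivative f' t) (at t within {a..b})" if "t \<in> {a..b}" for t
    using DERIV_subset[OF der[OF that] \<open>{a..b} \<subseteq> S\<close>] .
  then show "continuous_on {a..b} f" by (rule DERIV_continuous_on)
  fix t assume "a < t" "t < b"
  then have "(f has_real_derivative f' t) (at t)"
    using der'[of t] at_within_Icc_at[of a t b] by simp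
  then show "\<exists>y. (f has_real_derivative y) (at t) \<and> 0 \<le> y"
    using nonneg[of t] \<open>a < t\<close> \<open>t < b\<close> by auto
qed

lemma DERIV_zero_imp_eq_within:
  fixes f :: "real \<Rightarrow> real"
  assumes "a \<le> b" "{a..b} \<subseteq> S"
    and der: "\<And>t. t \<in> {a..b} \<Longrightarrow> (f has_real_derivative 0) (at t within S)"
  shows "f a = f b"
proof (rule antisym)
  show "f a \<le> f b" by (rule DERIV_nonneg_imp_le_within[OF assms]) auto
  have "- f a \<le> - f b"
    by (rule DERIV_nonneg_imp_le_within[OF assms(1,2), where f' = "\<lambda>_. 0"])
      (use DERIV_minus[OF der] in auto)
  then show "f b \<le> f a" by simp
qed

text \<open>The integrating factors exp (- K t) to the right of s and exp (K t) to the left make f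
  monotone towards 0. The bound is assumed only in a window around s, because the Lipschitz
  constants used for it are local.\<close>

lemma gronwall_zero:
  fixes f :: "real \<Rightarrow> real"
  assumes der: "\<And>t. t \<in> {a..b} \<Longrightarrow> (f has_real_derivative f' t) (at t within {a..b})"
    and bound: "\<And>t. t \<in> {a..b} \<Longrightarrow> \<bar>t - s\<bar> \<le> e \<Longrightarrow> \<bar>f' t\<bar> \<le> K * f t"
    and nonneg: "\<And>t. t \<in> {a..b} \<Longrightarrow> 0 \<le> f t"
    and s: "s \<in> {a..b}" "f s = 0"
    and t: "t \<in> {a..b}" "\<bar>t - s\<bar> \<le> e"
  shows "f t = 0"
proof -
  have "f t \<le> 0"
  proof (cases "s \<le> t")
    case True
    have "- (f s * exp (- K * s)) \<le> - (f t * exp (- K * t))"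
    proof (rule DERIV_nonneg_imp_le_within[OF True, of "{a..b}"])
      fix r assume r: "r \<in> {s..t}"
      then have r': "r \<in> {a..b}" "\<bar>r - s\<bar> \<le> e" using s t by auto
      show "((\<lambda>r. - (f r * exp (- K * r))) has_real_derivative
          (K * f r - f' r) * exp (- K * r)) (at r within {a..b})"
        by (rule derivative_eq_intros der r' refl | simp add: algebra_simps)+
      show "0 \<le> (K * f r - f' r) * exp (- K * r)" using bound[OF r'] by auto
    qed (use s t in auto)
    then show ?thesis using s by (simp add: mult_le_0_iff)
  next
    case False
    then have "t \<le> s" by simp
    have "f t * exp (K * t) \<le> f s * exp (K * s)"
    proof (rule DERIV_nonneg_imp_le_within[OF \<open>t \<le> s\<close>, of "{a..b}"])
      fix r assume r: "r \<in> {t..s}"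
      then have r': "r \<in> {a..b}" "\<bar>r - s\<bar> \<le> e" using s t by auto
      show "((\<lambda>r. f r * exp (K * r)) has_real_derivative
          (K * f r + f' r) * exp (K * r)) (at r within {a..b})"
        by (rule derivative_eq_intros der r' refl | simp add: algebra_simps)+
      show "0 \<le> (K * f r + f' r) * exp (K * r)" using bound[OF r'] by auto
    qed (use s t in auto)
    then show ?thesis using s by (simp add: mult_le_0_iff)
  qed
  with nonneg[OF t(1)] show ?thesis by simp
qed

text \<open>Continuity of g' at p bounds it by \<bar>g' p\<bar> + 1 near p, and the mean value
  inequality does the rest.\<close>

lemma DERIV_imp_locally_lipschitz:
  fixes g :: "real \<Rightarrow> real"
  assumes "0 < r" and der: "\<And>u. \<bar>u - p\<bar> < r \<Longrightarrow> (g has_real_derivative g' u) (at u)"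
    and cont: "isCont g' p"
  obtains d L where "0 < d" "0 \<le> L"
    "\<And>u v. \<bar>u - p\<bar> < d \<Longrightarrow> \<bar>v - p\<bar> < d \<Longrightarrow> \<bar>g u - g v\<bar> \<le> L * \<bar>u - v\<bar>"
proof -
  obtain d0 where d0: "0 < d0" "\<And>u. dist u p < d0 \<Longrightarrow> dist (g' u) (g' p) < 1"
    using cont unfolding continuous_at_eps_delta by (metis zero_less_one)
  define d where "d = min d0 r"
  have "\<bar>g u - g v\<bar> \<le> (\<bar>g' p\<bar> + 1) * \<bar>u - v\<bar>" if "\<bar>u - p\<bar> < d" "\<bar>v - p\<bar> < d" for u v
  proof -
    have "norm (g u - g v) \<le> (\<bar>g' p\<bar> + 1) * norm (u - v)"
    proof (rule field_differentiable_bound[of "ball p d"])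
      fix z assume "z \<in> ball p d"
      then have z: "\<bar>z - p\<bar> < d" by (auto simp: dist_real_def)
      then show "(g has_real_derivative g' z) (at z within ball p d)"
        using der[of z] has_field_derivative_at_within by (auto simp: d_def)
      show "norm (g' z) \<le> \<bar>g' p\<bar> + 1"
        using d0(2)[of z] z by (auto simp: d_def dist_real_def)
    qed (use that in \<open>auto simp: dist_real_def\<close>)
    then show ?thesis by simp
  qed
  then show ?thesis using that[of d "\<bar>g' p\<bar> + 1"] \<open>0 < r\<close> d0(1) by (auto simp: d_def)
qed

section \<open>Energy and uniqueness for the second-order equation\<close>

lemma continuous_on_eps_delta_real:
  fixes f :: "real \<Rightarrow> real"
  assumes "continuous_on S f" "s \<in> S" "0 < e"
  obtains d where "0 < d" "\<And>t. t \<in> S \<Longrightarrow> \<bar>t - s\<bar> < d \<Longrightarrow> \<bar>f t - f s\<bar> < e"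
  using assms unfolding continuous_on_iff dist_real_def by metis

definition solves_ode :: "real \<Rightarrow> real \<Rightarrow> real \<Rightarrow> (real \<Rightarrow> real) \<Rightarrow> (real \<Rightarrow> real) \<Rightarrow> bool" where
  "solves_ode q \<mu> T u u' \<longleftrightarrow> (\<forall>t\<in>{0..T}.
     (u has_real_derivative u' t) (at t within {0..T}) \<and>
     (u' has_real_derivative - \<mu> * signed_pow (q - 1) (u t)) (at t within {0..T}))"

lemma solves_odeD:
  assumes "solves_ode q \<mu> T u u'" "t \<in> {0..T}"
  shows "(u has_real_derivative u' t) (at t within {0..T})"
    "(u' has_real_derivative - \<mu> * signed_pow (q - 1) (u t)) (at t within {0..T})"
  using assms unfolding solves_ode_def by auto

lemma solves_ode_energy:
  assumes q: "1 < q" and sol: "solves_ode q \<mu> T u u'" and t: "t \<in> {0..T}"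
  shows "(u' t)\<^sup>2 + 2 * \<mu> / q * \<bar>u t\<bar> powr q = (u' 0)\<^sup>2 + 2 * \<mu> / q * \<bar>u 0\<bar> powr q"
proof -
  have "(u' 0)\<^sup>2 + 2 * \<mu> / q * \<bar>u 0\<bar> powr q = (u' t)\<^sup>2 + 2 * \<mu> / q * \<bar>u t\<bar> powr q"
  proof (rule DERIV_zero_imp_eq_within[of 0 t "{0..T}"])
    fix r assume "r \<in> {0..t}"
    then have r: "r \<in> {0..T}" using t by auto
    have "((\<lambda>t. (u' t)\<^sup>2 + 2 * \<mu> / q * \<bar>u t\<bar> powr q) has_real_derivative
        of_nat 2 * (- \<mu> * signed_pow (q - 1) (u r) * u' r ^ (2 - Suc 0))
          + 2 * \<mu> / q * (q * signed_pow (q - 1) (u r) * u' r)) (at r within {0..T})"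
      by (intro DERIV_add DERIV_cmult DERIV_power DERIV_chain2[OF DERIV_abs_powr]
          solves_odeD[OF sol r] q)
    then show "((\<lambda>t. (u' t)\<^sup>2 + 2 * \<mu> / q * \<bar>u t\<bar> powr q) has_real_derivative 0) (at r within {0..T})"
      using q by simp
  qed (use t in auto)
  then show ?thesis by simp
qed

text \<open>The times at which values and slopes both agree form a closed subset of a connected
  interval that contains 0. Openness is local uniqueness, proved by different means at zeros of the
  solution and elsewhere. The assumption a \<noteq> 0 makes the energy positive, so the slope is
  nonzero at every zero.\<close>

lemma solves_ode_unique:
  assumes q: "1 < q" and \<mu>: "0 < \<mu>" and T: "0 \<le> T"
    and x: "solves_ode q \<mu> T x x'" and y: "solves_ode q \<mu> T y y'"
    and init: "x 0 = 0" "y 0 = 0" "x' 0 = a" "y' 0 = a" and a: "a \<noteq> 0"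
    and t: "t \<in> {0..T}"
  shows "x t = y t"
proof -
  define E where "E = {t \<in> {0..T}. x t - y t = 0} \<inter> {t \<in> {0..T}. x' t - y' t = 0}"
  note dx = solves_odeD[OF x] and dy = solves_odeD[OF y]
  have cont: "continuous_on {0..T} x" "continuous_on {0..T} y"
    "continuous_on {0..T} x'" "continuous_on {0..T} y'"
    by (rule DERIV_continuous_on, erule dx dy)+
  have energy: "(x' t)\<^sup>2 + 2 * \<mu> / q * \<bar>x t\<bar> powr q = a\<^sup>2" "(y' t)\<^sup>2 + 2 * \<mu> / q * \<bar>y t\<bar> powr q = a\<^sup>2"
    if "t \<in> {0..T}" for t
    using solves_ode_energy[OF q x that] solves_ode_energy[OF q y that] init by simp_all
  have local: "\<exists>e>0. \<forall>t\<in>{0..T}. dist t s < e \<longrightarrow> t \<in> E" if "s \<in> E" for s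
  proof -
    have s: "s \<in> {0..T}" "x s = y s" "x' s = y' s" using that by (auto simp: E_def)
    show ?thesis
    proof (cases "y s = 0")
      case True
      \<comment> \<open>Here \<open>x'\<close> and \<open>y'\<close> do not vanish, so the energy identity is a Lipschitz first-order equation.\<close>
      then have "(y' s)\<^sup>2 = a\<^sup>2" using energy(2)[OF s(1)] by simp
      then have ys: "\<bar>y' s\<bar> = \<bar>a\<bar>" by (simp add: power2_eq_iff abs_eq_iff)
      obtain d L where d: "0 < d" "0 \<le> L" and L: "\<And>u v. \<bar>u - y s\<bar> < d \<Longrightarrow> \<bar>v - y s\<bar> < d \<Longrightarrow>
          \<bar>\<bar>u\<bar> powr q - \<bar>v\<bar> powr q\<bar> \<le> L * \<bar>u - v\<bar>"
        by (rule DERIV_imp_locally_lipschitz[where r = 1 and p = "y s" and g = "\<lambda>x. \<bar>x\<bar> powr q"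
              and g' = "\<lambda>x. q * signed_pow (q - 1) x"])
          (use q DERIV_abs_powr in \<open>auto intro!: continuous_intros isCont_signed_pow\<close>)
      obtain e1 where e1: "0 < e1" "\<And>t. t \<in> {0..T} \<Longrightarrow> \<bar>t - s\<bar> < e1 \<Longrightarrow> \<bar>x t - x s\<bar> < d"
        using continuous_on_eps_delta_real[OF cont(1) s(1) d(1)] by blast
      obtain e2 where e2: "0 < e2" "\<And>t. t \<in> {0..T} \<Longrightarrow> \<bar>t - s\<bar> < e2 \<Longrightarrow> \<bar>y t - y s\<bar> < d"
        using continuous_on_eps_delta_real[OF cont(2) s(1) d(1)] by blast
      \<comment> \<open>At s the two slopes coincide and have absolute value \<bar>a\<bar>, so their
        sum has absolute value 2 \<bar>a\<bar> and stays above \<bar>a\<bar> nearby.\<close>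
      obtain e3 where e3: "0 < e3"
        "\<And>t. t \<in> {0..T} \<Longrightarrow> \<bar>t - s\<bar> < e3 \<Longrightarrow> \<bar>(x' t + y' t) - (x' s + y' s)\<bar> < \<bar>a\<bar>"
        using continuous_on_eps_delta_real[OF continuous_on_add[OF cont(3,4)] s(1), of "\<bar>a\<bar>"] a by auto
      define e where "e = min e1 (min e2 e3) / 2"
      have e: "0 < e" "e < e1" "e < e2" "e < e3" using e1(1) e2(1) e3(1) by (auto simp: e_def)
      have sum: "\<bar>a\<bar> \<le> \<bar>x' t + y' t\<bar>" if "t \<in> {0..T}" "\<bar>t - s\<bar> \<le> e" for t
        using e3(2)[of t] that e ys s by auto
      \<comment> \<open>The difference of the two energy identities, with the difference of squares
        factored.\<close>
      have diff: "(x' t - y' t) * (x' t + y' t) = 2 * \<mu> / q * (\<bar>y t\<bar> powr q - \<bar>x t\<bar> powr q)"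
        if "t \<in> {0..T}" for t
        using energy[OF that] by (simp add: algebra_simps power2_eq_square)
      \<comment> \<open>The Lipschitz constant of the potential term divided by the lower bound for
        the sum of the slopes.\<close>
      define M where "M = 2 * \<mu> / q * L / \<bar>a\<bar>"
      have M: "\<bar>x' t - y' t\<bar> \<le> M * \<bar>x t - y t\<bar>" if t: "t \<in> {0..T}" "\<bar>t - s\<bar> \<le> e" for t
      proof -
        have "\<bar>x' t - y' t\<bar> * \<bar>a\<bar> \<le> \<bar>x' t - y' t\<bar> * \<bar>x' t + y' t\<bar>"
          using sum[OF t] by (intro mult_left_mono) auto
        also have "\<dots> = 2 * \<mu> / q * \<bar>\<bar>y t\<bar> powr q - \<bar>x t\<bar> powr q\<bar>"
          using q \<mu> by (simp flip: abs_mult add: diff[OF t(1)]) (simp add: abs_mult)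
        also have "\<dots> \<le> 2 * \<mu> / q * (L * \<bar>y t - x t\<bar>)"
          using e1(2)[of t] e2(2)[of t] t e s q \<mu> by (intro mult_left_mono L) auto
        finally have "\<bar>x' t - y' t\<bar> \<le> 2 * \<mu> / q * (L * \<bar>y t - x t\<bar>) / \<bar>a\<bar>"
          using a by (simp add: pos_le_divide_eq del: times_divide_eq_left times_divide_eq_right)
        then show ?thesis by (simp add: M_def abs_minus_commute mult.assoc)
      qed
      have x_eq: "x t = y t" if t: "t \<in> {0..T}" "\<bar>t - s\<bar> \<le> e" for t
      proof -
        have "(x t - y t)\<^sup>2 = 0"
        proof (rule gronwall_zero[where f = "\<lambda>t. (x t - y t)\<^sup>2" and K = "2 * M"
              and f' = "\<lambda>t. 2 * ((x t - y t) * (x' t - y' t))", OF _ _ _ s(1) _ t])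
          fix t assume t: "t \<in> {0..T}"
          show "((\<lambda>t. (x t - y t)\<^sup>2) has_real_derivative 2 * ((x t - y t) * (x' t - y' t)))
              (at t within {0..T})"
            by (rule derivative_eq_intros dx(1)[OF t] dy(1)[OF t] refl | simp)+
          assume "\<bar>t - s\<bar> \<le> e"
          from mult_left_mono[OF M[OF t this], of "2 * \<bar>x t - y t\<bar>"]
          have "\<bar>2 * ((x t - y t) * (x' t - y' t))\<bar> \<le> 2 * \<bar>x t - y t\<bar> * (M * \<bar>x t - y t\<bar>)"
            by (simp add: abs_mult mult.assoc)
          also have "\<dots> = 2 * M * \<bar>x t - y t\<bar>\<^sup>2" by (simp add: power2_eq_square del: abs_mult_self_eq)
          finally show "\<bar>2 * ((x t - y t) * (x' t - y' t))\<bar> \<le> 2 * M * (x t - y t)\<^sup>2" by simp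
        qed (use s in auto)
        then show ?thesis by simp
      qed
      moreover have "x' t = y' t" if t: "t \<in> {0..T}" "\<bar>t - s\<bar> \<le> e" for t
        using M[OF t] x_eq[OF t] by simp
      ultimately show ?thesis using e(1) by (intro exI[of _ e]) (auto simp: E_def dist_real_def)
    next
      \<comment> \<open>Away from 0 the right-hand side of the equation is Lipschitz, so the squared
        distance in the phase plane obeys a Gronwall bound. Its constant 1 + \<mu> L comes from 2 d
        e \<le> d^2 + e^2.\<close>
      case False
      have der: "(signed_pow (q - 1) has_real_derivative (q - 1) * \<bar>u\<bar> powr (q - 1 - 1)) (at u)"
        if "\<bar>u - y s\<bar> < \<bar>y s\<bar>" for u
        by (rule DERIV_signed_pow) (use that in auto)
      have cont': "isCont (\<lambda>u. (q - 1) * \<bar>u\<bar> powr (q - 1 - 1)) (y s)"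
        using False by (intro continuous_intros) auto
      have pos: "0 < \<bar>y s\<bar>" using False by simp
      obtain d L where d: "0 < d" "0 \<le> L" and L: "\<And>u v. \<bar>u - y s\<bar> < d \<Longrightarrow> \<bar>v - y s\<bar> < d \<Longrightarrow>
          \<bar>signed_pow (q - 1) u - signed_pow (q - 1) v\<bar> \<le> L * \<bar>u - v\<bar>"
        by (rule DERIV_imp_locally_lipschitz[OF pos _ cont']) (erule der, blast)
      obtain e1 where e1: "0 < e1" "\<And>t. t \<in> {0..T} \<Longrightarrow> \<bar>t - s\<bar> < e1 \<Longrightarrow> \<bar>x t - x s\<bar> < d"
        using continuous_on_eps_delta_real[OF cont(1) s(1) d(1)] by blast
      obtain e2 where e2: "0 < e2" "\<And>t. t \<in> {0..T} \<Longrightarrow> \<bar>t - s\<bar> < e2 \<Longrightarrow> \<bar>y t - y s\<bar> < d"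
        using continuous_on_eps_delta_real[OF cont(2) s(1) d(1)] by blast
      define e where "e = min e1 e2 / 2"
      have e: "0 < e" "e < e1" "e < e2" using e1(1) e2(1) by (auto simp: e_def)
      have zero: "(x t - y t)\<^sup>2 + (x' t - y' t)\<^sup>2 = 0" if t: "t \<in> {0..T}" "\<bar>t - s\<bar> \<le> e" for t
      proof (rule gronwall_zero[where f = "\<lambda>t. (x t - y t)\<^sup>2 + (x' t - y' t)\<^sup>2" and K = "1 + \<mu> * L"
            and f' = "\<lambda>t. 2 * ((x t - y t) * (x' t - y' t))
              - 2 * \<mu> * ((x' t - y' t) * (signed_pow (q - 1) (x t) - signed_pow (q - 1) (y t)))",
            OF _ _ _ s(1) _ t])
        fix t assume t: "t \<in> {0..T}"
        show "((\<lambda>t. (x t - y t)\<^sup>2 + (x' t - y' t)\<^sup>2) has_real_derivative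
            2 * ((x t - y t) * (x' t - y' t))
              - 2 * \<mu> * ((x' t - y' t) * (signed_pow (q - 1) (x t) - signed_pow (q - 1) (y t))))
            (at t within {0..T})"
          by (rule derivative_eq_intros dx[OF t] dy[OF t] refl | simp add: algebra_simps)+
        assume te: "\<bar>t - s\<bar> \<le> e"
        let ?d = "\<bar>x t - y t\<bar>" and ?e = "\<bar>x' t - y' t\<bar>"
        have lip: "\<bar>signed_pow (q - 1) (x t) - signed_pow (q - 1) (y t)\<bar> \<le> L * ?d"
          using e1(2)[OF t] e2(2)[OF t] te e s by (intro L) auto
        have "\<bar>2 * ((x t - y t) * (x' t - y' t))
            - 2 * \<mu> * ((x' t - y' t) * (signed_pow (q - 1) (x t) - signed_pow (q - 1) (y t)))\<bar>
          \<le> \<bar>2 * ((x t - y t) * (x' t - y' t))\<bar>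
            + \<bar>2 * \<mu> * ((x' t - y' t) * (signed_pow (q - 1) (x t) - signed_pow (q - 1) (y t)))\<bar>"
          by (rule abs_triangle_ineq4)
        also have "\<dots> = 2 * (?d * ?e)
            + 2 * \<mu> * (?e * \<bar>signed_pow (q - 1) (x t) - signed_pow (q - 1) (y t)\<bar>)"
          using \<mu> by (simp add: abs_mult)
        also have "\<dots> \<le> 2 * (?d * ?e) + 2 * \<mu> * (?e * (L * ?d))"
          using \<mu> lip by (intro add_left_mono mult_left_mono) auto
        also have "\<dots> = (1 + \<mu> * L) * (2 * (?d * ?e))" by (simp add: algebra_simps)
        also have "\<dots> \<le> (1 + \<mu> * L) * ((x t - y t)\<^sup>2 + (x' t - y' t)\<^sup>2)"
        proof (rule mult_left_mono)
          have "0 \<le> (?d - ?e)\<^sup>2" by simp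
          then show "2 * (?d * ?e) \<le> (x t - y t)\<^sup>2 + (x' t - y' t)\<^sup>2"
            unfolding power2_diff power2_abs by (simp add: mult.assoc)
        qed (use \<mu> d in auto)
        finally show "\<bar>2 * ((x t - y t) * (x' t - y' t))
            - 2 * \<mu> * ((x' t - y' t) * (signed_pow (q - 1) (x t) - signed_pow (q - 1) (y t)))\<bar>
          \<le> (1 + \<mu> * L) * ((x t - y t)\<^sup>2 + (x' t - y' t)\<^sup>2)" .
      qed (use s in auto)
      then show ?thesis using e(1)
        by (intro exI[of _ e]) (auto simp: E_def dist_real_def sum_power2_eq_zero_iff)
    qed
  qed
  have closed: "closedin (top_of_set {0..T}) E"
    unfolding E_def
    by (intro closedin_Int continuous_closedin_preimage_constant continuous_intros cont)
  have "openin (top_of_set {0..T}) E"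
    unfolding openin_euclidean_subtopology_iff using local by (auto simp: E_def)
  then have "E = {} \<or> E = {0..T}"
    using connected_clopen[THEN iffD1, rule_format, OF connected_Icc conjI[OF _ closed]] by simp
  moreover have "0 \<in> E" using init T by (simp add: E_def)
  ultimately have "t \<in> E" using t by (metis empty_iff)
  then show ?thesis by (simp add: E_def)
qed

section \<open>Passing between \<open>deriv_on\<close>, \<open>C1_on\<close> and derivatives within
  the interval\<close>

lemma deriv_on_eq:
  assumes "0 < T" "t \<in> {0..T}" "(f has_real_derivative D) (at t within {0..T})"
  shows "deriv_on T f t = D"
  using assms unfolding deriv_on_def
  by (intro vector_derivative_within_closed_interval)
    (auto simp: has_real_derivative_iff_has_vector_derivative)

lemma C1_onD:
  assumes "C1_on T f" "t \<in> {0..T}"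
  shows "(f has_real_derivative deriv_on T f t) (at t within {0..T})"
  using assms unfolding C1_on_def deriv_on_def has_real_derivative_iff_has_vector_derivative
  by (simp add: vector_derivative_works)

lemma C1_onI:
  assumes "0 < T" "\<And>t. t \<in> {0..T} \<Longrightarrow> (f has_real_derivative f' t) (at t within {0..T})"
    and "continuous_on {0..T} f'"
  shows "C1_on T f"
proof -
  have "continuous_on {0..T} (deriv_on T f)"
    using assms(3) by (rule continuous_on_eq) (rule deriv_on_eq[OF assms(1) _ assms(2), symmetric])
  then show ?thesis
    unfolding C1_on_def
    using assms(2)[unfolded has_real_derivative_iff_has_vector_derivative, THEN differentiableI_vector]
    by blast
qed

section \<open>Eigenpairs\<close>

lemma conj_exp_gt_1: "1 < p \<Longrightarrow> 1 < conj_exp p"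
  by (simp add: conj_exp_def field_simps)

lemma conj_exp_inverses: "1 < p \<Longrightarrow> 1 / p + 1 / conj_exp p = 1"
  by (simp add: conj_exp_def field_simps)

lemma conj_exp_pred_mult: "1 < p \<Longrightarrow> (p - 1) * (conj_exp p - 1) = 1"
  by (simp add: conj_exp_def field_simps)

lemma conj_exp_mult: "1 < p \<Longrightarrow> p * conj_exp p = p + conj_exp p"
  by (simp add: conj_exp_def field_simps)

text \<open>Since (p - 1) (q - 1) = 1 for q = \<open>conj_exp p\<close>, the two signed powers are
  inverse to each other, and u'' can be recovered from w. The derivatives become existential
  witnesses, which makes substitutions easy.\<close>

lemma eigenpair_iff_system:
  assumes p: "1 < p" and t0: "0 < t0"
  shows "eigenpair p t0 u lam \<longleftrightarrow>
    0 < lam \<and> (\<exists>t\<in>{0..t0}. u t \<noteq> 0) \<and> u 0 = 0 \<and> u t0 = 0 \<and>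
    (\<exists>u' w w'. w 0 = 0 \<and> w t0 = 0 \<and> (\<forall>t\<in>{0..t0}.
       (u has_real_derivative u' t) (at t within {0..t0}) \<and>
       (u' has_real_derivative signed_pow (conj_exp p - 1) (w t)) (at t within {0..t0}) \<and>
       (w has_real_derivative w' t) (at t within {0..t0}) \<and>
       (w' has_real_derivative lam * signed_pow (conj_exp p - 1) (u t)) (at t within {0..t0})))"
    (is "?L \<longleftrightarrow> ?R")
proof
  define r where "r = conj_exp p - 1"
  have r: "0 < r" using conj_exp_gt_1[OF p] by (simp add: r_def)
  have inv: "signed_pow (p - 1) (signed_pow r x) = x" "signed_pow r (signed_pow (p - 1) x) = x" for x
    using conj_exp_pred_mult[OF p] by (simp_all add: signed_pow_signed_pow r_def mult.commute)
  {
    assume ?L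
    then have E: "0 < lam" "\<exists>t\<in>{0..t0}. u t \<noteq> 0" "C1_on t0 u" "C1_on t0 (deriv_on t0 u)"
      "C1_on t0 (\<lambda>t. signed_pow (p - 1) (deriv_on t0 (deriv_on t0 u) t))"
      "C1_on t0 (deriv_on t0 (\<lambda>t. signed_pow (p - 1) (deriv_on t0 (deriv_on t0 u) t)))"
      "\<And>t. t \<in> {0..t0} \<Longrightarrow>
        deriv_on t0 (deriv_on t0 (\<lambda>t. signed_pow (p - 1) (deriv_on t0 (deriv_on t0 u) t))) t
        = lam * signed_pow r (u t)"
      "u 0 = 0" "u t0 = 0" "deriv_on t0 (deriv_on t0 u) 0 = 0" "deriv_on t0 (deriv_on t0 u) t0 = 0"
      unfolding eigenpair_def Let_def r_def by blast+
    have "(deriv_on t0 u has_real_derivative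
        signed_pow r (signed_pow (p - 1) (deriv_on t0 (deriv_on t0 u) t))) (at t within {0..t0})"
      if "t \<in> {0..t0}" for t
      using C1_onD[OF E(4) that] by (simp add: inv)
    moreover have "(deriv_on t0 (\<lambda>t. signed_pow (p - 1) (deriv_on t0 (deriv_on t0 u) t))
        has_real_derivative lam * signed_pow r (u t)) (at t within {0..t0})" if "t \<in> {0..t0}" for t
      using C1_onD[OF E(6) that] by (simp add: E(7)[OF that])
    ultimately show ?R
      unfolding r_def[symmetric]
      using E(1,2,8-11) C1_onD[OF E(3)] C1_onD[OF E(5)]
      by (intro conjI exI[of _ "deriv_on t0 u"]
          exI[of _ "\<lambda>t. signed_pow (p - 1) (deriv_on t0 (deriv_on t0 u) t)"]
          exI[of _ "deriv_on t0 (\<lambda>t. signed_pow (p - 1) (deriv_on t0 (deriv_on t0 u) t))"]) auto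
  next
    assume ?R
    then obtain u' w w' where R: "0 < lam" "\<exists>t\<in>{0..t0}. u t \<noteq> 0" "u 0 = 0" "u t0 = 0" "w 0 = 0" "w t0 = 0"
      and du: "\<And>t. t \<in> {0..t0} \<Longrightarrow> (u has_real_derivative u' t) (at t within {0..t0})"
      and du': "\<And>t. t \<in> {0..t0} \<Longrightarrow> (u' has_real_derivative signed_pow r (w t)) (at t within {0..t0})"
      and dw: "\<And>t. t \<in> {0..t0} \<Longrightarrow> (w has_real_derivative w' t) (at t within {0..t0})"
      and dw': "\<And>t. t \<in> {0..t0} \<Longrightarrow> (w' has_real_derivative lam * signed_pow r (u t)) (at t within {0..t0})"
      unfolding r_def by blast
    \<comment> \<open>These are the functions that \<open>eigenpair\<close> builds. They agree with
      the witnesses on the interval only, which suffices because all derivatives are taken within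
      it.\<close>
    define u1 where "u1 = deriv_on t0 u"
    define u2 where "u2 = deriv_on t0 u1"
    define v where "v = (\<lambda>t. signed_pow (p - 1) (u2 t))"
    define v1 where "v1 = deriv_on t0 v"
    note cont = DERIV_continuous_on
    have u1: "u1 t = u' t" if "t \<in> {0..t0}" for t
      unfolding u1_def by (rule deriv_on_eq[OF t0 that du[OF that]])
    have du1: "(u1 has_real_derivative signed_pow r (w t)) (at t within {0..t0})" if "t \<in> {0..t0}" for t
      using du'[OF that] that u1 by (rule has_real_derivative_transform_on)
    have u2: "u2 t = signed_pow r (w t)" if "t \<in> {0..t0}" for t
      unfolding u2_def by (rule deriv_on_eq[OF t0 that du1[OF that]])
    have v: "v t = w t" if "t \<in> {0..t0}" for t
      by (simp add: v_def u2[OF that] inv)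
    have dv: "(v has_real_derivative w' t) (at t within {0..t0})" if "t \<in> {0..t0}" for t
      using dw[OF that] that v by (rule has_real_derivative_transform_on)
    have v1: "v1 t = w' t" if "t \<in> {0..t0}" for t
      unfolding v1_def by (rule deriv_on_eq[OF t0 that dv[OF that]])
    have dv1: "(v1 has_real_derivative lam * signed_pow r (u t)) (at t within {0..t0})"
      if "t \<in> {0..t0}" for t
      using dw'[OF that] that v1 by (rule has_real_derivative_transform_on)
    have "C1_on t0 u" by (rule C1_onI[OF t0 du cont[OF du']])
    moreover have "C1_on t0 u1"
      by (rule C1_onI[OF t0 du1]) (auto intro: continuous_on_signed_pow[OF r cont[OF dw]])
    moreover have "C1_on t0 v" by (rule C1_onI[OF t0 dv cont[OF dw']])
    moreover have "C1_on t0 v1"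
      by (rule C1_onI[OF t0 dv1])
        (auto intro!: continuous_on_mult_left continuous_on_signed_pow[OF r cont[OF du]])
    moreover have "\<forall>t\<in>{0..t0}. deriv_on t0 v1 t = lam * signed_pow r (u t)"
      using deriv_on_eq[OF t0 _ dv1] by blast
    moreover have "u2 0 = 0" "u2 t0 = 0" using u2[of 0] u2[of t0] R t0 by auto
    ultimately show ?L
      using R(1-4)
      unfolding eigenpair_def Let_def u1_def[symmetric] u2_def[symmetric]
        v_def[symmetric] v1_def[symmetric] r_def[symmetric]
      by blast
  }
qed

text \<open>Since \<open>signed_pow r\<close> is increasing, \<open>(u - v) (u - v)'\<close> is nondecreasing, and it vanishes at
  both end points.\<close>

lemma symmetric_system_eq:
  assumes \<mu>: "0 < \<mu>" and r: "0 \<le> r" and T: "0 \<le> T"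
    and du: "\<And>t. t \<in> {0..T} \<Longrightarrow> (u has_real_derivative u' t) (at t within {0..T})"
    and du': "\<And>t. t \<in> {0..T} \<Longrightarrow> (u' has_real_derivative - \<mu> * signed_pow r (v t)) (at t within {0..T})"
    and dv: "\<And>t. t \<in> {0..T} \<Longrightarrow> (v has_real_derivative v' t) (at t within {0..T})"
    and dv': "\<And>t. t \<in> {0..T} \<Longrightarrow> (v' has_real_derivative - \<mu> * signed_pow r (u t)) (at t within {0..T})"
    and bc: "u 0 = v 0" "u T = v T"
    and t: "t \<in> {0..T}"
  shows "u t = v t"
proof -
  define G where "G t = (u t - v t) * (u' t - v' t)" for t
  have mono: "G a \<le> G b" if "0 \<le> a" "a \<le> b" "b \<le> T" for a b
  proof (rule DERIV_nonneg_imp_le_within[OF \<open>a \<le> b\<close>, of "{0..T}"])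
    fix s assume "s \<in> {a..b}"
    then have s: "s \<in> {0..T}" using that by auto
    show "(G has_real_derivative
        (u' s - v' s)\<^sup>2 + \<mu> * ((u s - v s) * (signed_pow r (u s) - signed_pow r (v s))))
        (at s within {0..T})"
      unfolding G_def[abs_def]
      by (rule derivative_eq_intros du[OF s] du'[OF s] dv[OF s] dv'[OF s] refl
          | simp add: power2_eq_square algebra_simps)+
    have "0 \<le> (u s - v s) * (signed_pow r (u s) - signed_pow r (v s))"
      using signed_pow_mono[OF r, of "u s" "v s"] signed_pow_mono[OF r, of "v s" "u s"]
      by (cases "u s \<le> v s") (auto simp: mult_nonpos_nonpos)
    then show "0 \<le> (u' s - v' s)\<^sup>2 + \<mu> * ((u s - v s) * (signed_pow r (u s) - signed_pow r (v s)))"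
      using \<mu> by auto
  qed (use that in auto)
  have zero: "G s = 0" if "s \<in> {0..T}" for s
    using mono[of 0 s] mono[of s T] that bc by (simp add: G_def)
  \<comment> \<open>The square of u - v has derivative 2 G, which is 0 because G is monotone between
    two zero values.\<close>
  have "(u 0 - v 0)\<^sup>2 = (u t - v t)\<^sup>2"
  proof (rule DERIV_zero_imp_eq_within[of 0 t "{0..T}"])
    fix s assume "s \<in> {0..t}"
    then have s: "s \<in> {0..T}" using t by auto
    have "((\<lambda>t. (u t - v t)\<^sup>2) has_real_derivative 2 * G s) (at s within {0..T})"
      unfolding G_def by (rule derivative_eq_intros du[OF s] dv[OF s] refl | simp)+
    then show "((\<lambda>t. (u t - v t)\<^sup>2) has_real_derivative 0) (at s within {0..T})"
      by (simp add: zero[OF s])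
  qed (use t in auto)
  then show ?thesis using bc by simp
qed

text \<open>From left to right, the symmetric system forces u to be a multiple of w; from right to
  left, w is taken to be the corresponding multiple of u.\<close>

lemma eigenpair_iff_ode:
  assumes p: "1 < p" and t0: "0 < t0"
  shows "eigenpair p t0 u lam \<longleftrightarrow>
    0 < lam \<and> (\<exists>t\<in>{0..t0}. u t \<noteq> 0) \<and> u 0 = 0 \<and> u t0 = 0 \<and>
    (\<exists>u'. solves_ode (conj_exp p) (lam powr (1 / p)) t0 u u')"
    (is "?L \<longleftrightarrow> ?R")
proof
  define q where "q = conj_exp p"
  define \<mu> where "\<mu> = lam powr (1 / p)"
  note q = conj_exp_gt_1[OF p, folded q_def]
  {
    assume ?L
    then obtain u' w w' where R: "0 < lam" "\<exists>t\<in>{0..t0}. u t \<noteq> 0" "u 0 = 0" "u t0 = 0" "w 0 = 0" "w t0 = 0"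
      and du: "\<And>t. t \<in> {0..t0} \<Longrightarrow> (u has_real_derivative u' t) (at t within {0..t0})"
      and du': "\<And>t. t \<in> {0..t0} \<Longrightarrow> (u' has_real_derivative signed_pow (q - 1) (w t)) (at t within {0..t0})"
      and dw: "\<And>t. t \<in> {0..t0} \<Longrightarrow> (w has_real_derivative w' t) (at t within {0..t0})"
      and dw': "\<And>t. t \<in> {0..t0} \<Longrightarrow> (w' has_real_derivative lam * signed_pow (q - 1) (u t)) (at t within {0..t0})"
      unfolding eigenpair_iff_system[OF p t0] q_def by blast
    have \<mu>: "0 < \<mu>" using R by (simp add: \<mu>_def)
    \<comment> \<open>The scaling v = -\<kappa> w is symmetric if \<kappa> lam = \<mu> and \<mu>
      \<kappa> powr (q - 1) = 1; these two conditions determine both \<kappa> and \<mu>.\<close>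
    define \<kappa> where "\<kappa> = lam powr (- (1 / q))"
    have \<kappa>: "0 < \<kappa>" using R by (simp add: \<kappa>_def)
    have "\<kappa> * lam = lam powr (- (1 / q)) * lam powr 1" using R by (simp add: \<kappa>_def)
    also have "\<dots> = lam powr (- (1 / q) + 1)" by (simp only: powr_add)
    also have "- (1 / q) + 1 = 1 / p" using conj_exp_inverses[OF p] by (simp add: q_def)
    finally have \<kappa>_lam: "\<kappa> * lam = \<mu>" by (simp add: \<mu>_def)
    have "\<kappa> powr (q - 1) = lam powr (- (1 / q) * (q - 1))" unfolding \<kappa>_def powr_powr ..
    also have "- (1 / q) * (q - 1) = - (1 / p)"
      using conj_exp_inverses[OF p, folded q_def] q by (simp add: field_simps)
    finally have "\<mu> * \<kappa> powr (q - 1) = lam powr (1 / p) * lam powr (- (1 / p))"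
      by (simp only: \<mu>_def)
    also have "\<dots> = 1" using R by (simp flip: powr_add)
    finally have \<mu>_\<kappa>: "\<mu> * \<kappa> powr (q - 1) = 1" .
    have u_eq: "u t = - \<kappa> * w t" if "t \<in> {0..t0}" for t
    proof (rule symmetric_system_eq[where u' = u' and v' = "\<lambda>t. - \<kappa> * w' t" and r = "q - 1" and v = "\<lambda>t. - \<kappa> * w t",
          OF \<mu> _ _ du _ _ _ _ _ that])
      fix t assume t: "t \<in> {0..t0}"
      have "- \<mu> * signed_pow (q - 1) (- \<kappa> * w t) = (\<mu> * \<kappa> powr (q - 1)) * signed_pow (q - 1) (w t)"
        using \<kappa> by (simp add: signed_pow_mult signed_pow_pos)
      then show "(u' has_real_derivative - \<mu> * signed_pow (q - 1) (- \<kappa> * w t)) (at t within {0..t0})"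
        using du'[OF t] \<mu>_\<kappa> by simp
      show "((\<lambda>t. - \<kappa> * w t) has_real_derivative - \<kappa> * w' t) (at t within {0..t0})"
        by (rule DERIV_cmult[OF dw[OF t]])
      have "((\<lambda>t. - \<kappa> * w' t) has_real_derivative - \<kappa> * (lam * signed_pow (q - 1) (u t))) (at t within {0..t0})"
        by (rule DERIV_cmult[OF dw'[OF t]])
      then show "((\<lambda>t. - \<kappa> * w' t) has_real_derivative - \<mu> * signed_pow (q - 1) (u t)) (at t within {0..t0})"
        by (simp flip: \<kappa>_lam add: mult.assoc)
    qed (use q t0 R in auto)
    have "(u' has_real_derivative - \<mu> * signed_pow (q - 1) (u t)) (at t within {0..t0})" if t: "t \<in> {0..t0}" for t
    proof -
      have "- \<mu> * signed_pow (q - 1) (u t) = (\<mu> * \<kappa> powr (q - 1)) * signed_pow (q - 1) (w t)"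
        unfolding u_eq[OF t] using \<kappa> by (simp add: signed_pow_mult signed_pow_pos)
      then show ?thesis using du'[OF t] \<mu>_\<kappa> by simp
    qed
    then show ?R using R du unfolding solves_ode_def \<mu>_def q_def by blast
  next
    assume ?R
    then obtain u' where R: "0 < lam" "\<exists>t\<in>{0..t0}. u t \<noteq> 0" "u 0 = 0" "u t0 = 0"
      and ode: "solves_ode q \<mu> t0 u u'"
      unfolding q_def \<mu>_def by blast
    have \<mu>: "0 < \<mu>" using R by (simp add: \<mu>_def)
    \<comment> \<open>The inverse of the \<kappa> above, written in terms of \<mu>: it has \<nu>
      \<mu> = lam and \<nu> powr (q - 1) = \<mu>.\<close>
    define \<nu> where "\<nu> = \<mu> powr (p - 1)"
    have "\<nu> * \<mu> powr 1 = \<mu> powr (p - 1 + 1)" unfolding \<nu>_def powr_add ..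
    then have "\<nu> * \<mu> = \<mu> powr p" using \<mu> by simp
    also have "\<dots> = lam" using p R by (simp add: \<mu>_def powr_powr)
    finally have \<nu>_\<mu>: "\<nu> * \<mu> = lam" .
    have \<nu>: "0 < \<nu>" using \<mu> by (simp add: \<nu>_def)
    have \<nu>_pow: "\<nu> powr (q - 1) = \<mu>"
      using conj_exp_pred_mult[OF p, folded q_def] \<mu> by (simp add: \<nu>_def powr_powr)
    show ?L
      unfolding eigenpair_iff_system[OF p t0] q_def[symmetric]
    proof (intro conjI exI ballI)
      show "- \<nu> * u 0 = 0" "- \<nu> * u t0 = 0" using R by simp_all
      fix t assume t: "t \<in> {0..t0}"
      show "(u has_real_derivative u' t) (at t within {0..t0})" by (rule solves_odeD(1)[OF ode t])
      have "signed_pow (q - 1) (- \<nu> * u t) = - \<mu> * signed_pow (q - 1) (u t)"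
        using \<nu> by (simp add: signed_pow_mult signed_pow_pos \<nu>_pow)
      then show "(u' has_real_derivative signed_pow (q - 1) (- \<nu> * u t)) (at t within {0..t0})"
        using solves_odeD(2)[OF ode t] by simp
      show "((\<lambda>t. - \<nu> * u t) has_real_derivative - \<nu> * u' t) (at t within {0..t0})"
        by (rule DERIV_cmult[OF solves_odeD(1)[OF ode t]])
      show "((\<lambda>t. - \<nu> * u' t) has_real_derivative lam * signed_pow (q - 1) (u t)) (at t within {0..t0})"
        using DERIV_cmult[OF solves_odeD(2)[OF ode t], of "- \<nu>"] by (simp flip: \<nu>_\<mu> add: mult.assoc)
    qed (use R in auto)
  }
qed

section \<open>Explicit solutions, their zeros and their sign changes\<close>

context
  fixes q :: real
  assumes q: "1 < q"
begin

lemma DERIV_scaled_gsin: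
  "((\<lambda>t. b * gsin q (\<omega> * t)) has_real_derivative b * \<omega> * gcos q (\<omega> * t)) (at t within S)"
  "((\<lambda>t. b * \<omega> * gcos q (\<omega> * t)) has_real_derivative
      - (b * \<omega>\<^sup>2 * (q / 2)) * signed_pow (q - 1) (gsin q (\<omega> * t))) (at t within S)"
  by (rule derivative_eq_intros DERIV_chain2[OF DERIV_gsin[OF q]] DERIV_chain2[OF DERIV_gcos[OF q]] refl
      | simp add: power2_eq_square)+

text \<open>The nonlinearity is homogeneous of degree q - 1 and the second derivative of degree 1,
  so the amplitude enters \<mu> with exponent 2 - q. The sign e passes through because the
  nonlinearity is odd.\<close>

lemma solves_ode_gsin:
  assumes c: "0 < c" and e: "e = 1 \<or> e = -1"
  shows "solves_ode q (q / 2 * \<omega>\<^sup>2 * c powr (2 - q)) T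
    (\<lambda>t. e * c * gsin q (\<omega> * t)) (\<lambda>t. e * c * \<omega> * gcos q (\<omega> * t))"
proof -
  have "c powr (2 - q) * c powr (q - 1) = c powr 1" by (simp only: powr_add[symmetric]) simp
  then have cc: "c powr (2 - q) * c powr (q - 1) = c" using c by simp
  have "signed_pow (q - 1) e = e" using e by (auto simp: signed_pow_def)
  then have eq: "- (q / 2 * \<omega>\<^sup>2 * c powr (2 - q)) * signed_pow (q - 1) (e * c * s)
      = - (q / 2 * \<omega>\<^sup>2 * (c powr (2 - q) * c powr (q - 1))) * (e * signed_pow (q - 1) s)" for s
    using c by (simp add: signed_pow_mult signed_pow_pos)
  have "- (q / 2 * \<omega>\<^sup>2 * c powr (2 - q)) * signed_pow (q - 1) (e * c * s)
      = - (e * c * \<omega>\<^sup>2 * (q / 2)) * signed_pow (q - 1) s" for s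
    unfolding eq cc by (simp add: mult_ac)
  then show ?thesis
    unfolding solves_ode_def using DERIV_scaled_gsin[of "e * c" \<omega>] by (simp only: Ball_def simp_thms)
qed

text \<open>Amplitude and frequency are chosen to match the initial slope and \<mu>; uniqueness then
  identifies the solution.\<close>

lemma solves_ode_imp_gsin:
  assumes \<mu>: "0 < \<mu>" and T: "0 \<le> T" and ode: "solves_ode q \<mu> T u u'"
    and u0: "u 0 = 0" and nz: "\<exists>t\<in>{0..T}. u t \<noteq> 0"
  obtains c \<omega> e where "0 < c" "0 < \<omega>" "e = 1 \<or> e = -1" "\<mu> = q / 2 * \<omega>\<^sup>2 * c powr (2 - q)"
    "\<And>t. t \<in> {0..T} \<Longrightarrow> u t = e * c * gsin q (\<omega> * t)"
proof -
  \<comment> \<open>With slope 0 at the start the energy is 0, and both of its terms are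
    nonnegative, so the solution would vanish identically.\<close>
  have u'0: "u' 0 \<noteq> 0"
  proof
    assume "u' 0 = 0"
    have "u t = 0" if "t \<in> {0..T}" for t
    proof -
      have "(u' t)\<^sup>2 + 2 * \<mu> / q * \<bar>u t\<bar> powr q = 0"
        using solves_ode_energy[OF q ode that] u0 \<open>u' 0 = 0\<close> by simp
      moreover have "0 \<le> 2 * \<mu> / q * \<bar>u t\<bar> powr q" using \<mu> q by simp
      moreover have "0 \<le> (u' t)\<^sup>2" by simp
      ultimately have "2 * \<mu> / q * \<bar>u t\<bar> powr q = 0" by linarith
      then show ?thesis using \<mu> q by simp
    qed
    with nz show False by blast
  qed
  define a where "a = \<bar>u' 0\<bar>"
  define e where "e = sgn (u' 0)"
  \<comment> \<open>The amplitude at which all energy is potential: 2 \<mu> / q * c powr q = a^2.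
    Then \<omega> follows from the slope c \<omega> = a at 0.\<close>
  define c where "c = (q * a\<^sup>2 / (2 * \<mu>)) powr (1 / q)"
  define \<omega> where "\<omega> = a / c"
  have a: "0 < a" using u'0 by (simp add: a_def)
  have c: "0 < c" using a q \<mu> by (simp add: c_def)
  have e: "e = 1 \<or> e = -1" using u'0 by (simp add: e_def sgn_if)
  have cq: "c powr q = q * a\<^sup>2 / (2 * \<mu>)" using a q \<mu> by (simp add: c_def powr_powr)
  have "c powr (2 - q) = c powr 2 / c powr q" by (rule powr_diff)
  then have "c powr (2 - q) = c\<^sup>2 / (q * a\<^sup>2 / (2 * \<mu>))" using c by (simp add: cq)
  then have \<mu>_eq: "\<mu> = q / 2 * \<omega>\<^sup>2 * c powr (2 - q)"
    using a c q \<mu> by (simp add: \<omega>_def power_divide field_simps)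
  have "u t = e * c * gsin q (\<omega> * t)" if "t \<in> {0..T}" for t
  proof (rule solves_ode_unique[OF q \<mu> T ode solves_ode_gsin[OF c e, of \<omega> T, folded \<mu>_eq] u0 _ refl _ u'0 that])
    show "e * c * \<omega> * gcos q (\<omega> * 0) = u' 0"
      using c q by (simp add: \<omega>_def a_def e_def sgn_mult_abs)
  qed (simp add: q)
  with c e \<mu>_eq a show ?thesis by (intro that[of c \<omega> e]) (auto simp: \<omega>_def)
qed

lemma gsin_eq_0:
  assumes "0 < t" "gsin q t = 0"
  obtains n :: nat where "1 \<le> n" "t = real n * gtime q pi"
proof -
  have "sin (gangle q t) = 0" using assms(2) sgn_signed_pow[of "2 / q" "sin (gangle q t)"]
    by (simp add: gsin_def sgn_0_0)
  then obtain k :: int where k: "gangle q t = of_int k * pi" by (auto simp: sin_zero_iff_int2)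
  have "0 < gangle q t" using assms(1) gangle_less_iff(2)[OF q, of 0 t] by simp
  then have "0 < k" by (simp add: k zero_less_mult_iff)
  then obtain n where n: "k = int n" "1 \<le> n" using zero_less_imp_eq_int by force
  have "t = gtime q (real n * pi)" using k n gtime_gangle[OF q, of t] by simp
  then show ?thesis using that n by (simp add: gtime_of_nat_pi q)
qed

lemma gsin_plus_nat: "gsin q (t + real n * gtime q pi) = (-1) ^ n * gsin q t"
proof (induction n)
  case (Suc n)
  show ?case using gsin_plus[OF q, of "t + real n * gtime q pi"] Suc by (simp add: algebra_simps)
qed simp

text \<open>The weak inequality includes both ends of the half-wave, so an index found by rounding
  down needs no separate case at the zeros.\<close>

lemma gsin_sign:
  assumes "real k * gtime q pi \<le> t" "t \<le> (real k + 1) * gtime q pi"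
  shows "0 \<le> (-1) ^ k * gsin q t"
proof -
  define r where "r = t - real k * gtime q pi"
  have r: "0 \<le> r" "r \<le> gtime q pi" using assms by (auto simp: r_def algebra_simps)
  have "0 \<le> gangle q r" "gangle q r \<le> pi"
    using r gangle_less_iff(1)[OF q, of r 0] gangle_less_iff(2)[OF q, of pi r] by auto
  then have "0 \<le> sin (gangle q r)" by (rule sin_ge_zero)
  then have "0 \<le> gsin q r" by (simp add: gsin_def signed_pow_def)
  moreover have "gsin q t = (-1) ^ k * gsin q r"
    using gsin_plus_nat[of r k] by (simp add: r_def)
  ultimately show ?thesis by (simp flip: power_add mult.assoc)
qed

lemma gsin_pi_half: "gsin q (gtime q pi / 2) = 1"
  by (simp add: gsin_def gtime_pi_half[OF q, symmetric] q signed_pow_def)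

text \<open>The zeros cut the interval into n half-waves, and within one of them no sign change is
  possible. So k changes need points in k + 1 different half-waves, and one point in each half-wave
  attains this.\<close>

lemma at_least_sign_changes_gsin_iff:
  assumes b: "b \<noteq> 0" and t0: "0 < t0" and n: "1 \<le> n"
    and u: "\<And>t. t \<in> {0..t0} \<Longrightarrow> u t = b * gsin q (gtime q pi * real n * t / t0)"
  shows "at_least_sign_changes u {0<..<t0} k \<longleftrightarrow> k < n"
proof
  define h where "h = gtime q pi"
  have h: "0 < h" using gtime_pi_pos[OF q] by (simp add: h_def)
  have prod: "u x * u y = b\<^sup>2 * (gsin q (h * real n * x / t0) * gsin q (h * real n * y / t0))"
    if "x \<in> {0<..<t0}" "y \<in> {0<..<t0}" for x y
    using that u[of x] u[of y] by (simp add: power2_eq_square h_def)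
  {
    assume "at_least_sign_changes u {0<..<t0} k"
    then obtain s where s: "\<And>i. i \<le> k \<Longrightarrow> s i \<in> {0<..<t0}"
      "\<And>i. i < k \<Longrightarrow> s i < s (Suc i)" "\<And>i. i < k \<Longrightarrow> u (s i) * u (s (Suc i)) < 0"
      unfolding at_least_sign_changes_def by blast
    \<comment> \<open>The index, counted from 0, of the half-wave that contains
      \<open>s i\<close>.\<close>
    define K where "K i = nat \<lfloor>real n * s i / t0\<rfloor>" for i
    have K: "real (K i) \<le> real n * s i / t0" "real n * s i / t0 < real (K i) + 1" if "i \<le> k" for i
    proof -
      have "0 \<le> real n * s i / t0" using s(1)[OF that] t0 by simp
      then have "0 \<le> \<lfloor>real n * s i / t0\<rfloor>" by simp
      then have "real (K i) = of_int \<lfloor>real n * s i / t0\<rfloor>" by (simp add: K_def)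
      then show "real (K i) \<le> real n * s i / t0" "real n * s i / t0 < real (K i) + 1" by linarith+
    qed
    have sign: "0 \<le> (-1) ^ K i * gsin q (h * real n * s i / t0)" if "i \<le> k" for i
    proof (rule gsin_sign, unfold h_def[symmetric])
      have e: "h * real n * s i / t0 = (real n * s i / t0) * h" by simp
      show "real (K i) * h \<le> h * real n * s i / t0" "h * real n * s i / t0 \<le> (real (K i) + 1) * h"
        unfolding e by (rule mult_right_mono[OF _ less_imp_le[OF h]], use K[OF that] in linarith)+
    qed
    \<comment> \<open>Rounding down preserves the order of the points, and equal indices would make
      the product of neighbouring values nonnegative. Hence the indices increase strictly.\<close>
    have "i \<le> K i" if "i \<le> k" for i
      using that
    proof (induction i)
      case (Suc i)
      have le: "i \<le> k" "Suc i \<le> k" "i < k" using Suc by auto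
      have "real n * s i / t0 < real n * s (Suc i) / t0"
        using s(2)[OF le(3)] n t0 by (simp add: divide_strict_right_mono)
      then have "K i < K (Suc i) + 1" using K[OF le(1)] K[OF le(2)] by linarith
      moreover have "K i \<noteq> K (Suc i)"
      proof
        assume eq: "K i = K (Suc i)"
        have "0 \<le> ((-1) ^ K i * gsin q (h * real n * s i / t0))
            * ((-1) ^ K (Suc i) * gsin q (h * real n * s (Suc i) / t0))"
          by (intro mult_nonneg_nonneg sign le)
        also have "\<dots> = ((-1) ^ K (Suc i) * (-1) ^ K (Suc i))
            * (gsin q (h * real n * s i / t0) * gsin q (h * real n * s (Suc i) / t0))"
          unfolding eq by (simp only: mult_ac)
        also have "(-1) ^ K (Suc i) * (-1) ^ K (Suc i) = (1::real)"
          by (simp flip: power_mult_distrib)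
        finally have "0 \<le> u (s i) * u (s (Suc i))"
          unfolding prod[OF s(1)[OF le(1)] s(1)[OF le(2)]] by simp
        with s(3)[OF le(3)] show False by simp
      qed
      ultimately show ?case using Suc le by simp
    qed simp
    then have "k \<le> K k" by simp
    moreover have "real (K k) < real n"
    proof -
      have "real n * s k / t0 < real n" using s(1)[of k] n t0 by (simp add: field_simps)
      then show ?thesis using K(1)[of k] by simp
    qed
    ultimately show "k < n" by simp
  next
    assume k: "k < n"
    \<comment> \<open>Midpoints of the half-waves, where \<open>gsin\<close> is 1 or -1. The last
      one, \<open>s k\<close>, is inside the interval because k + 1 \<le> n.\<close>
    define s where "s i = (real i + 1 / 2) * t0 / real n" for i :: nat
    have s: "s i \<in> {0<..<t0}" if "i \<le> k" for i
    proof -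
      have "real i + 1 \<le> real n" using that k by linarith
      then have "(real i + 1 / 2) * t0 < real n * t0" using t0 by (intro mult_strict_right_mono) auto
      then show ?thesis using n t0 by (simp add: s_def pos_divide_less_eq mult.commute)
    qed
    have val: "gsin q (h * real n * s i / t0) = (-1) ^ i" for i
    proof -
      have "h * real n * s i / t0 = h / 2 + real i * h"
        using n t0 by (simp add: s_def field_simps)
      then show ?thesis using gsin_plus_nat[of "h / 2" i] gsin_pi_half by (simp add: h_def)
    qed
    show "at_least_sign_changes u {0<..<t0} k"
      unfolding at_least_sign_changes_def
    proof (intro exI[of _ s] conjI allI impI)
      fix i assume i: "i < k"
      then have le: "i \<le> k" "Suc i \<le> k" by auto
      show "s i < s (Suc i)" using n t0 by (simp add: s_def divide_strict_right_mono)
      have "(-1) ^ i * (-1) ^ Suc i = (-1 :: real)" by (simp flip: power_mult_distrib)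
      then show "u (s i) * u (s (Suc i)) < 0"
        unfolding prod[OF s[OF le(1)] s[OF le(2)]] val using b by simp
    qed (use s in blast)
  }
qed

end

section \<open>The eigenvalue formula and the classification of eigenpairs\<close>

lemma eigval_eq:
  assumes p: "1 < p" and t0: "0 < t0"
  shows "eigval p t0 n c =
    (conj_exp p * (pi_rs 2 (conj_exp p))\<^sup>2 * (real n)\<^sup>2 / (2 * t0\<^sup>2)) powr p
      * c powr (p - conj_exp p)"
proof -
  define q where "q = conj_exp p"
  note q = conj_exp_gt_1[OF p, folded q_def]
  have pi: "pi_rs p 2 = q / 2 * pi_rs 2 q"
    using pi_rs_to_2[OF q] pi_rs_2[OF q] conj_exp_inverses[OF p] by (simp add: q_def)
  have "t0 powr (2 * p) = (t0 powr 2) powr p" by (simp only: powr_powr)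
  then have "t0 powr (2 * p) = (t0\<^sup>2) powr p" using t0 by simp
  moreover have "0 \<le> pi_rs 2 q * pi_rs p 2 * (real n)\<^sup>2"
    using q by (simp add: pi pi_rs_2 less_imp_le[OF gtime_pi_pos])
  ultimately have "(pi_rs 2 q * pi_rs p 2 * (real n)\<^sup>2) powr p / t0 powr (2 * p)
      = (pi_rs 2 q * pi_rs p 2 * (real n)\<^sup>2 / t0\<^sup>2) powr p"
    by (simp add: powr_divide)
  moreover have "pi_rs 2 q * pi_rs p 2 * (real n)\<^sup>2 / t0\<^sup>2
      = q * (pi_rs 2 q)\<^sup>2 * (real n)\<^sup>2 / (2 * t0\<^sup>2)"
    by (simp add: pi power2_eq_square)
  ultimately show ?thesis unfolding eigval_def q_def[symmetric] by simp
qed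

lemma eigfun_eq_gsin:
  assumes "1 < p"
  shows "eigfun p t0 n c t
    = c * gsin (conj_exp p) (gtime (conj_exp p) pi * real n * t / t0)"
  using conj_exp_gt_1[OF assms] by (simp add: eigfun_def sin_rs_2 pi_rs_2)

text \<open>The base is the coefficient \<mu> of the second-order equation. Conjugacy in the form p
  q = p + q gives (2 - q) p = p - q, the exponent of c.\<close>

lemma eigval_eq_powr:
  assumes p: "1 < p" and t0: "0 < t0" and n: "1 \<le> n" and c: "0 < c"
    and \<omega>: "\<omega> = gtime (conj_exp p) pi * real n / t0"
  shows "eigval p t0 n c = (conj_exp p / 2 * \<omega>\<^sup>2 * c powr (2 - conj_exp p)) powr p"
proof -
  define q where "q = conj_exp p"
  note q = conj_exp_gt_1[OF p, folded q_def]
  have "(2 - q) * p = p - q" using conj_exp_mult[OF p] by (simp add: q_def algebra_simps)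
  then have "(c powr (2 - q)) powr p = c powr (p - q)" by (simp add: powr_powr)
  moreover have "q * (pi_rs 2 q)\<^sup>2 * (real n)\<^sup>2 / (2 * t0\<^sup>2) = q / 2 * \<omega>\<^sup>2"
    by (simp add: \<omega> pi_rs_2 q q_def[symmetric] power_mult_distrib power_divide)
  ultimately show ?thesis
    by (simp only: eigval_eq[OF p t0] q_def[symmetric] powr_mult)
qed

lemma eigenpair_cong:
  assumes "1 < p" "0 < t0" "eigenpair p t0 u lam" "\<And>t. t \<in> {0..t0} \<Longrightarrow> v t = u t"
  shows "eigenpair p t0 v lam"
proof -
  obtain u' where *: "0 < lam" "\<exists>t\<in>{0..t0}. u t \<noteq> 0" "u 0 = 0" "u t0 = 0"
    "solves_ode (conj_exp p) (lam powr (1 / p)) t0 u u'"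
    using assms(3) unfolding eigenpair_iff_ode[OF assms(1,2)] by blast
  have "(v has_real_derivative u' t) (at t within {0..t0})" if "t \<in> {0..t0}" for t
    using solves_odeD(1)[OF *(5) that] that assms(4) by (rule has_real_derivative_transform_on)
  then have "solves_ode (conj_exp p) (lam powr (1 / p)) t0 v u'"
    using *(5) assms(4) by (simp add: solves_ode_def)
  moreover have "\<exists>t\<in>{0..t0}. v t \<noteq> 0" "v 0 = 0" "v t0 = 0" using *(2-4) assms by auto
  ultimately show ?thesis unfolding eigenpair_iff_ode[OF assms(1,2)] using *(1) by blast
qed

lemma eigenpair_scaled_gsin:
  assumes p: "1 < p" and t0: "0 < t0" and n: "1 \<le> n" and c: "0 < c" and e: "e = 1 \<or> e = -1"
  shows "eigenpair p t0 (\<lambda>t. e * eigfun p t0 n c t) (eigval p t0 n c)"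
proof -
  define q where "q = conj_exp p"
  note q = conj_exp_gt_1[OF p, folded q_def]
  define \<omega> where "\<omega> = gtime q pi * real n / t0"
  define \<mu> where "\<mu> = q / 2 * \<omega>\<^sup>2 * c powr (2 - q)"
  have \<omega>: "0 < \<omega>" using gtime_pi_pos[OF q] n t0 by (simp add: \<omega>_def)
  have \<mu>: "0 < \<mu>" using \<omega> c q by (simp add: \<mu>_def)
  have lam: "eigval p t0 n c = \<mu> powr p"
    unfolding \<mu>_def q_def by (rule eigval_eq_powr[OF p t0 n c]) (simp add: \<omega>_def q_def)
  have u: "e * eigfun p t0 n c t = e * c * gsin q (\<omega> * t)" for t
    by (simp add: eigfun_eq_gsin[OF p] q_def[symmetric] \<omega>_def)
  show ?thesis
    unfolding eigenpair_iff_ode[OF p t0] q_def[symmetric] u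
  proof (intro conjI exI)
    show "0 < eigval p t0 n c" using \<mu> by (simp add: lam)
    have root: "(eigval p t0 n c) powr (1 / p) = \<mu>" using p \<mu> by (simp add: lam powr_powr)
    show "solves_ode q (eigval p t0 n c powr (1 / p)) t0 (\<lambda>t. e * c * gsin q (\<omega> * t))
        (\<lambda>t. e * c * \<omega> * gcos q (\<omega> * t))"
      unfolding root \<mu>_def by (rule solves_ode_gsin[OF q c e])
    have "\<omega> * t0 = 0 + real n * gtime q pi" using t0 by (simp add: \<omega>_def)
    then show "e * c * gsin q (\<omega> * t0) = 0"
      using gsin_plus_nat[OF q, of 0 n] q by simp
    \<comment> \<open>The middle of the first half-wave witnesses that the function is not
      identically 0.\<close>
    have half: "\<omega> * (t0 / (2 * real n)) = gtime q pi / 2" using t0 n by (simp add: \<omega>_def)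
    have "e * c * gsin q (\<omega> * (t0 / (2 * real n))) \<noteq> 0"
      unfolding half gsin_pi_half[OF q] using e c by auto
    moreover have "t0 / (2 * real n) \<in> {0..t0}" using t0 n by (simp add: field_simps)
    ultimately show "\<exists>t\<in>{0..t0}. e * c * gsin q (\<omega> * t) \<noteq> 0" by blast
  qed (use q in simp)
qed

text \<open>The initial value problem leaves \<omega> free; the condition at t0 makes \<omega> t0 a
  positive zero of \<open>gsin\<close>, and this is where n comes from.\<close>

lemma eigenpair_imp_eigfun:
  assumes p: "1 < p" and t0: "0 < t0" and pair: "eigenpair p t0 u lam"
  obtains n c e where "1 \<le> n" "0 < c" "e = 1 \<or> e = -1" "lam = eigval p t0 n c"
    "\<And>t. t \<in> {0..t0} \<Longrightarrow> u t = e * eigfun p t0 n c t"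
proof -
  define q where "q = conj_exp p"
  note q = conj_exp_gt_1[OF p, folded q_def]
  obtain u' where R: "0 < lam" "\<exists>t\<in>{0..t0}. u t \<noteq> 0" "u 0 = 0" "u t0 = 0"
    and ode: "solves_ode q (lam powr (1 / p)) t0 u u'"
    using pair unfolding eigenpair_iff_ode[OF p t0] q_def by blast
  have "0 < lam powr (1 / p)" using R by simp
  from solves_ode_imp_gsin[OF q this less_imp_le[OF t0] ode R(3,2)]
  obtain c \<omega> e where c: "0 < c" and \<omega>: "0 < \<omega>" and e: "e = 1 \<or> e = -1"
    and \<mu>: "lam powr (1 / p) = q / 2 * \<omega>\<^sup>2 * c powr (2 - q)"
    and u: "\<And>t. t \<in> {0..t0} \<Longrightarrow> u t = e * c * gsin q (\<omega> * t)" by metis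
  have "gsin q (\<omega> * t0) = 0" using u[of t0] R t0 c e by auto
  then obtain n where n: "1 \<le> n" "\<omega> * t0 = real n * gtime q pi"
    using gsin_eq_0[OF q, of "\<omega> * t0"] \<omega> t0 by auto
  then have \<omega>_eq: "\<omega> = gtime q pi * real n / t0" using t0 by (simp add: field_simps)
  have "lam = (lam powr (1 / p)) powr p" using R p by (simp add: powr_powr)
  also have "\<dots> = eigval p t0 n c"
    unfolding \<mu> using eigval_eq_powr[OF p t0 n(1) c, of \<omega>] \<omega>_eq by (simp add: q_def)
  finally have "lam = eigval p t0 n c" .
  moreover have "u t = e * eigfun p t0 n c t" if "t \<in> {0..t0}" for t
    using u[OF that] by (simp add: eigfun_eq_gsin[OF p] q_def[symmetric] \<omega>_eq)
  ultimately show ?thesis using that n c e by blast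
qed

text \<open>For p > 1, p equals its conjugate exponent only if p = 2. Otherwise c enters through a
  power with nonzero exponent and a nonzero coefficient, and so can be recovered.\<close>

lemma eigval_inject:
  assumes p: "1 < p" "p \<noteq> 2" and t0: "0 < t0" and n: "1 \<le> n" and c: "0 < c" "0 < d"
    and eq: "eigval p t0 n c = eigval p t0 n d"
  shows "c = d"
proof -
  define q where "q = conj_exp p"
  note q = conj_exp_gt_1[OF p(1), folded q_def]
  have "p - q \<noteq> 0" using p by (simp add: q_def conj_exp_def field_simps)
  have "0 < pi_rs 2 q" using pi_rs_2[OF q] gtime_pi_pos[OF q] by simp
  then have "q * (pi_rs 2 q)\<^sup>2 * (real n)\<^sup>2 / (2 * t0\<^sup>2) \<noteq> 0"
    using q n t0 by simp
  then have "c powr (p - q) = d powr (p - q)"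
    using eq unfolding eigval_eq[OF p(1) t0] q_def[symmetric]
    by (simp only: mult_cancel_left powr_eq_0_iff simp_thms)
  then have "(c powr (p - q)) powr (1 / (p - q)) = (d powr (p - q)) powr (1 / (p - q))" by simp
  then show ?thesis using \<open>p - q \<noteq> 0\<close> c by (simp add: powr_powr)
qed

text \<open>The existential keeps only the sign of the slope, which is what tells e = 1 from e = -1.
  The number itself is c \<omega>, as \<open>gcos q 0 = 1\<close>.\<close>

lemma deriv_on_eigfun_0:
  assumes p: "1 < p" and t0: "0 < t0" and n: "1 \<le> n" and c: "0 < c"
    and u: "\<And>t. t \<in> {0..t0} \<Longrightarrow> u t = e * eigfun p t0 n c t"
  shows "\<exists>a>0. deriv_on t0 u 0 = e * a"
proof -
  define q where "q = conj_exp p"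
  note q = conj_exp_gt_1[OF p, folded q_def]
  define \<omega> where "\<omega> = gtime q pi * real n / t0"
  have "0 < c * \<omega>" using gtime_pi_pos[OF q] n t0 c by (simp add: \<omega>_def)
  have "((\<lambda>t. e * c * gsin q (\<omega> * t)) has_real_derivative e * c * \<omega> * gcos q (\<omega> * 0))
      (at 0 within {0..t0})"
    by (rule DERIV_scaled_gsin[OF q])
  then have "(u has_real_derivative e * c * \<omega> * gcos q (\<omega> * 0)) (at 0 within {0..t0})"
    by (rule has_real_derivative_transform_on)
      (use t0 in \<open>auto simp: u eigfun_eq_gsin[OF p] q_def \<omega>_def\<close>)
  then have "deriv_on t0 u 0 = e * (c * \<omega>)"
    using deriv_on_eq[OF t0, of 0] t0 q by simp
  with \<open>0 < c * \<omega>\<close> show ?thesis by blast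
qed

lemma changes_sign_exactly_eigfun_iff:
  assumes p: "1 < p" and t0: "0 < t0" and n: "1 \<le> n" and c: "0 < c" and e: "e = 1 \<or> e = -1"
    and u: "\<And>t. t \<in> {0..t0} \<Longrightarrow> u t = e * eigfun p t0 n c t"
  shows "changes_sign_exactly u {0<..<t0} k \<longleftrightarrow> n = k + 1"
proof -
  have "at_least_sign_changes u {0<..<t0} k \<longleftrightarrow> k < n" for k
  proof (rule at_least_sign_changes_gsin_iff[OF conj_exp_gt_1[OF p] _ t0 n])
    show "e * c \<noteq> 0" using e c by auto
  qed (simp add: u eigfun_eq_gsin[OF p])
  then have "changes_sign_exactly u {0<..<t0} k \<longleftrightarrow> k < n \<and> \<not> Suc k < n"
    by (simp only: changes_sign_exactly_def)
  then show ?thesis by linarith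
qed

text \<open>The equation is odd in u, so the negative of each \<open>eigfun\<close> is an
  eigenfunction as well; the third conjunct says that there are no others. Equality is asserted on
  \<open>{0..t0}\<close> only, because being an eigenpair does not depend on values
  elsewhere.\<close>

theorem theorem6p2:
  fixes p t0 :: real
  assumes "1 < p" and "0 < t0"
  shows "(\<forall>n\<ge>1. \<forall>c>0.
            eigval p t0 n c =
              (conj_exp p * (pi_rs 2 (conj_exp p))\<^sup>2 * (real n)\<^sup>2 / (2 * t0\<^sup>2)) powr p
                * c powr (p - conj_exp p))
    \<and> (\<forall>n\<ge>1. \<forall>c>0. eigenpair p t0 (eigfun p t0 n c) (eigval p t0 n c))
    \<and> (\<forall>u lam. eigenpair p t0 u lam \<longleftrightarrow>
          (\<exists>n\<ge>1. \<exists>c>0. lam = eigval p t0 n c \<and>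
             ((\<forall>t\<in>{0..t0}. u t = eigfun p t0 n c t) \<or>
              (\<forall>t\<in>{0..t0}. u t = - eigfun p t0 n c t))))
    \<and> (p \<noteq> 2 \<longrightarrow> (\<forall>n\<ge>1. \<forall>c>0. \<forall>u.
          eigenpair p t0 u (eigval p t0 n c) \<and> deriv_on t0 u 0 > 0 \<and>
            changes_sign_exactly u {0<..<t0} (n - 1)
          \<longleftrightarrow> (\<forall>t\<in>{0..t0}. u t = eigfun p t0 n c t)))"
proof (intro conjI allI impI)
  fix n :: nat and c :: real assume n: "1 \<le> n" and c: "0 < c"
  show "eigval p t0 n c =
      (conj_exp p * (pi_rs 2 (conj_exp p))\<^sup>2 * (real n)\<^sup>2 / (2 * t0\<^sup>2)) powr p
        * c powr (p - conj_exp p)"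
    by (rule eigval_eq[OF assms])
  have pair: "eigenpair p t0 (eigfun p t0 n c) (eigval p t0 n c)"
    using eigenpair_scaled_gsin[OF assms n c, of 1] by simp
  then show "eigenpair p t0 (eigfun p t0 n c) (eigval p t0 n c)" .
  assume p2: "p \<noteq> 2"
  fix u :: "real \<Rightarrow> real"
  show "eigenpair p t0 u (eigval p t0 n c) \<and> deriv_on t0 u 0 > 0 \<and>
      changes_sign_exactly u {0<..<t0} (n - 1) \<longleftrightarrow> (\<forall>t\<in>{0..t0}. u t = eigfun p t0 n c t)"
    (is "?L \<longleftrightarrow> ?R")
  proof
    assume L: ?L
    then obtain m d e where m: "1 \<le> m" and d: "0 < d" and e: "e = 1 \<or> e = -1"
      and lam: "eigval p t0 n c = eigval p t0 m d"
      and u: "\<And>t. t \<in> {0..t0} \<Longrightarrow> u t = e * eigfun p t0 m d t"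
      using eigenpair_imp_eigfun[OF assms] by metis
    \<comment> \<open>Each condition fixes one parameter: the number of sign changes gives m, then
      the eigenvalue gives d because p \<noteq> 2, and the slope gives e.\<close>
    have "m = n"
      using L changes_sign_exactly_eigfun_iff[OF assms m d e u] n by simp
    moreover from this have "c = d"
      using eigval_inject[OF assms(1) p2 assms(2) n c d] lam by simp
    moreover have "e = 1" using deriv_on_eigfun_0[OF assms m d u] L e by auto
    ultimately show ?R using u by simp
  next
    assume ?R
    then have u: "u t = eigfun p t0 n c t" "u t = 1 * eigfun p t0 n c t" if "t \<in> {0..t0}" for t
      using that by auto
    show ?L
      using eigenpair_cong[OF assms pair u(1)] deriv_on_eigfun_0[OF assms n c u(2)]
        changes_sign_exactly_eigfun_iff[OF assms n c _ u(2)] n by auto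
  qed
next
  fix u :: "real \<Rightarrow> real" and lam :: real
  show "eigenpair p t0 u lam \<longleftrightarrow>
      (\<exists>n\<ge>1. \<exists>c>0. lam = eigval p t0 n c \<and>
         ((\<forall>t\<in>{0..t0}. u t = eigfun p t0 n c t) \<or> (\<forall>t\<in>{0..t0}. u t = - eigfun p t0 n c t)))"
    (is "?L \<longleftrightarrow> ?R")
  proof
    assume ?L
    from eigenpair_imp_eigfun[OF assms this] obtain n c e where
      *: "1 \<le> n" "0 < c" "e = 1 \<or> e = -1" "lam = eigval p t0 n c"
      and u: "\<And>t. t \<in> {0..t0} \<Longrightarrow> u t = e * eigfun p t0 n c t"
      by metis
    have "(\<forall>t\<in>{0..t0}. u t = eigfun p t0 n c t) \<or> (\<forall>t\<in>{0..t0}. u t = - eigfun p t0 n c t)"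
      using *(3) u by auto
    with * show ?R by blast
  next
    assume ?R
    then obtain n c e where *: "1 \<le> n" "0 < c" "e = 1 \<or> e = -1" "lam = eigval p t0 n c"
      and u: "\<And>t. t \<in> {0..t0} \<Longrightarrow> u t = e * eigfun p t0 n c t"
      by (metis mult_1 mult_minus1)
    show ?L
      unfolding *(4) by (rule eigenpair_cong[OF assms eigenpair_scaled_gsin[OF assms *(1-3)] u])
  qed
qed

end
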